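(* Let $(X,T)$ be a minimal topological dynamical system with $T$ a homeomorphism, and let $\phi: X\to X_\infty=X/\mathbf{RP}^{[\infty]}(X)$ be the factor map onto its maximal $\infty$-step nilfactor. Then the following statements are equivalent: (1) $(X,T)$ is strongly $\mathcal{F}_{fip}$-sensitive; (2) $(X,T)$ is block $\mathcal{F}_{ip}$-sensitive; (3) there exists $\delta>0$ such that for every $x\in X$ there exists $y\in X$ with $(x,y)\in\mathbf{RP}^{[\infty]}(X)$ and $d(x,y)\ge\delta$; (4) $\phi$ is not almost one-to-one.
   Context: A topological dynamical system $(X,T)$: compact metric space $(X,d)$, $T$ continuous surjective; minimal means every orbit is dense. For a finite or infinite sequence $(p_i)_{i\in I}$ in $\mathbb{N}$, $FS((p_i)_{i\in I})$ is the set of sums $\sum_{i\in\alpha}p_i$ over finite nonempty $\alpha\subset I$; when $|I|=n$ finite it is a finite IP-set of length $n$. $\mathcal{F}_{fip}$ is the family of subsets of $\mathbb{Z}_+$ containing finite IP-sets of arbitrarily long lengths. For a family $\mathcal{F}$ of subsets of $\mathbb{Z}_+$, $(X,T)$ is strongly $\mathcal{F}$-sensitive if there is $\delta>0$ such that for each nonempty open $U\subset X$ there are $x,y\in U$ with $\{n\in\mathbb{Z}_+: d(T^nx,T^ny)>\delta\}\in\mathcal{F}$. $(X,T)$ is block $\mathcal{F}_{ip}$-sensitive if there is $\delta>0$ such that for each $x\in X$, each neighborhood $U$ of $x$ and each $l\in\mathbb{N}$ there is $y_l\in U$ such that $\{n\in\mathbb{Z}_+: d(T^nx,T^ny_l)>\delta\}$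 contains a finite IP-set of length $l$. For $d\in\mathbb{N}$, $(x,y)\in\mathbf{RP}^{[d]}(X)$ if for every $\delta>0$ there are $x',y'\in X$ and $\mathbf{n}=(n_1,\dots,n_d)\in\mathbb{Z}^d$ with $d(x,x')<\delta$, $d(y,y')<\delta$ and $d(T^{\mathbf{n}\cdot\varepsilon}x',T^{\mathbf{n}\cdot\varepsilon}y')<\delta$ for all $\varepsilon\in\{0,1\}^d\setminus\{(0,\dots,0)\}$, where $\mathbf{n}\cdot\varepsilon=\sum_i\varepsilon_in_i$. $\mathbf{RP}^{[\infty]}(X)=\bigcap_{d\ge1}\mathbf{RP}^{[d]}(X)$, a closed invariant equivalence relation for minimal systems. A factor map $\phi$ is almost one-to-one if $\{x\in X:\phi^{-1}(\phi(x))=\{x\}\}$ is dense in $X$. *)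

theory Defs
  imports "HOL-Analysis.Analysis"
begin

definition tds :: "'a::metric_space set \<Rightarrow> ('a \<Rightarrow> 'a) \<Rightarrow> bool" where
  "tds X T \<longleftrightarrow> compact X \<and> X \<noteq> {} \<and> continuous_on X T \<and> T ` X = X"

definition minimal_sys :: "'a::metric_space set \<Rightarrow> ('a \<Rightarrow> 'a) \<Rightarrow> bool" where
  "minimal_sys X T \<longleftrightarrow> (\<forall>x\<in>X. X \<subseteq> closure {(T ^^ n) x | n. True})"

definition tpow :: "'a set \<Rightarrow> ('a \<Rightarrow> 'a) \<Rightarrow> int \<Rightarrow> 'a \<Rightarrow> 'a" where
  "tpow X T k x = (if 0 \<le> k then (T ^^ nat k) x else (the_inv_into X T ^^ nat (- k)) x)"

definition FS :: "(nat \<Rightarrow> nat) \<Rightarrow> nat \<Rightarrow> nat set" where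
  "FS p n = {\<Sum>i\<in>\<alpha>. p i | \<alpha>. \<alpha> \<subseteq> {..<n} \<and> \<alpha> \<noteq> {}}"

definition contains_fip :: "nat set \<Rightarrow> nat \<Rightarrow> bool" where
  "contains_fip S l \<longleftrightarrow> (\<exists>p. (\<forall>i<l. 0 < p i) \<and> FS p l \<subseteq> S)"

definition F_fip :: "nat set set" where
  "F_fip = {S. \<forall>l. contains_fip S l}"

definition strongly_F_sensitive :: "nat set set \<Rightarrow> 'a::metric_space set \<Rightarrow> ('a \<Rightarrow> 'a) \<Rightarrow> bool" where
  "strongly_F_sensitive F X T \<longleftrightarrow> (\<exists>\<delta>>0. \<forall>U. openin (top_of_set X) U \<and> U \<noteq> {} \<longrightarrow>
     (\<exists>x\<in>U. \<exists>y\<in>U. {n. dist ((T ^^ n) x) ((T ^^ n) y) > \<delta>} \<in> F))"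

definition block_Fip_sensitive :: "'a::metric_space set \<Rightarrow> ('a \<Rightarrow> 'a) \<Rightarrow> bool" where
  "block_Fip_sensitive X T \<longleftrightarrow> (\<exists>\<delta>>0. \<forall>x\<in>X. \<forall>U. openin (top_of_set X) U \<and> x \<in> U \<longrightarrow>
     (\<forall>l\<ge>1. \<exists>y\<in>U. contains_fip {n. dist ((T ^^ n) x) ((T ^^ n) y) > \<delta>} l))"

text \<open>Regionally proximal relation of order d. Vectors n in Z^d are functions nat => int
  on {..<d}; epsilon in {0,1}^d minus 0 corresponds to a nonempty E subset of {..<d}.\<close>

definition RP :: "'a::metric_space set \<Rightarrow> ('a \<Rightarrow> 'a) \<Rightarrow> nat \<Rightarrow> ('a \<times> 'a) set" where
  "RP X T d = {(x, y). x \<in> X \<and> y \<in> X \<and> (\<forall>\<delta>>0. \<exists>x'\<in>X. \<exists>y'\<in>X. \<exists>n::nat \<Rightarrow> int.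
      dist x x' < \<delta> \<and> dist y y' < \<delta> \<and>
      (\<forall>E. E \<subseteq> {..<d} \<and> E \<noteq> {} \<longrightarrow>
         dist (tpow X T (\<Sum>i\<in>E. n i) x') (tpow X T (\<Sum>i\<in>E. n i) y') < \<delta>))}"

definition RP_inf :: "'a::metric_space set \<Rightarrow> ('a \<Rightarrow> 'a) \<Rightarrow> ('a \<times> 'a) set" where
  "RP_inf X T = (\<Inter>d\<in>{1..}. RP X T d)"

definition nil_factor_map :: "'a::metric_space set \<Rightarrow> ('a \<Rightarrow> 'a) \<Rightarrow> 'a \<Rightarrow> 'a set" where
  "nil_factor_map X T x = {y. (x, y) \<in> RP_inf X T}"

definition almost_one_to_one :: "'a::metric_space set \<Rightarrow> ('a \<Rightarrow> 'b) \<Rightarrow> bool" where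
  "almost_one_to_one X \<phi> \<longleftrightarrow> X \<subseteq> closure {x\<in>X. {z\<in>X. \<phi> z = \<phi> x} = {x}}"

end

theory Submission
  imports Defs
begin

text \<open>The core is the pointwise description of the relation: if \<open>(x, y)\<close> is regionally proximal of all
  orders, then for every \<open>d\<close> the limits of the face transformations contain one that maps \<open>x\<close> to \<open>y\<close>
  at every nonzero vertex of the \<open>d\<close>-cube. This gives transitivity by composition, and it gives finite
  IP-sets in the return times from \<open>x\<close> to any neighbourhood of \<open>y\<close>. It is obtained from Ellis
  semigroups: a minimal idempotent \<open>u\<close> of the flow yields a minimal idempotent of the face semigroup
  (Glasner's trick), and every \<open>u\<close>-fixed element of the cube semigroup with value \<open>u\<close> at the origin
  already lies in the face semigroup; so any cube based at \<open>x\<close> can be moved by face transformations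
  to the constant one.

  Folkman's theorem then makes finite IP-sets partition regular, which turns a sensitive pair into a
  proximal pair at positive distance. Conversely, when all \<open>x\<close> have a partner \<open>y\<close> at distance \<open>\<delta>\<close>, a
  Baire category argument produces one point near \<open>x\<close> that returns near \<open>x\<close> along finite IP-sets of all
  lengths along which \<open>x\<close> is near \<open>y\<close>.\<close>

section \<open>Compact right topological semigroups\<close>

text \<open>The definition of the relation only provides moving points \<open>x'\<close>,
  \<open>y'\<close> near \<open>x\<close>, \<open>y\<close>, and limits of face transformations are
  in general discontinuous, so approximations cannot be pushed through them. The way out is to keep
  exact values at the single point \<open>x\<close>: minimality replaces \<open>x'\<close> and
  \<open>y'\<close> by points of the orbit of \<open>x\<close>, which turns a regionally proximal
  pair of order d into an element of the (d+1)-dimensional cube semigroup evaluated at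
  \<open>x\<close>. Membership in the cube semigroup is easy to obtain; membership in the smaller
  face semigroup, where the origin stays at \<open>x\<close>, has to be earned, and the group around
  a minimal idempotent supplies the inverses for this. The same semigroup theory yields Folkman's
  theorem, with shifts of colourings in place of the flow. On the way back to sensitivity the
  exponents are integers of any sign and must be made positive. Moreover each length has its own
  IP-set and its own witness, whereas \<open>F_fip\<close> asks for one pair serving all lengths;
  this forces the category argument.\<close>

lemma open_coord_vimage:
  fixes W :: "'b::topological_space set"
  shows "open W \<Longrightarrow> open ((\<lambda>h::'a \<Rightarrow> 'b. h i) -` W)"
  by (intro open_vimage continuous_on_product_coordinates) 

instance "fun" :: (type, t0_space) t0_space
proof
  fix f g :: "'a \<Rightarrow> 'b" assume "f \<noteq> g"
  then obtain i where "f i \<noteq> g i" by auto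
  then obtain U where "open U" "(f i \<in> U) \<noteq> (g i \<in> U)"
    using separation_t0[of "f i" "g i"] by auto
  then show "\<exists>U. open U \<and> \<not> (f \<in> U \<longleftrightarrow> g \<in> U)"
    by (intro exI[of _ "(\<lambda>h. h i) -` U"]) (simp add: open_coord_vimage)
qed

instance "fun" :: (type, t1_space) t1_space
proof
  fix f g :: "'a \<Rightarrow> 'b" assume "f \<noteq> g"
  then obtain i where "f i \<noteq> g i" by auto
  then obtain U where "open U" "f i \<in> U" "g i \<notin> U"
    using separation_t1[of "f i" "g i"] by auto
  then show "\<exists>U. open U \<and> f \<in> U \<and> g \<notin> U"
    by (intro exI[of _ "(\<lambda>h. h i) -` U"]) (simp add: open_coord_vimage)
qed

text \<open>Hausdorffness of the product topology makes compact images of ideals closed.\<close>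

instance "fun" :: (type, t2_space) t2_space
proof
  fix f g :: "'a \<Rightarrow> 'b" assume "f \<noteq> g"
  then obtain i where "f i \<noteq> g i" by auto
  then obtain U V where "open U" "open V" "f i \<in> U" "g i \<in> V" "U \<inter> V = {}"
    using hausdorff[of "f i" "g i"] by metis
  moreover from this have "(\<lambda>h. h i) -` U \<inter> (\<lambda>h::'a \<Rightarrow> 'b. h i) -` V = {}" by blast
  ultimately show "\<exists>U V. open U \<and> open V \<and> f \<in> U \<and> g \<in> V \<and> U \<inter> V = {}"
    by (intro exI[of _ "(\<lambda>h. h i) -` U"] exI[of _ "(\<lambda>h. h i) -` V"])
       (simp add: open_coord_vimage)
qed

lemma compact_Pi_UNIV:
  fixes K :: "'i \<Rightarrow> 'b::topological_space set"
  assumes "\<And>i. compact (K i)" shows "compact {f. \<forall>i. f i \<in> K i}"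
proof -
  have "compactin (product_topology (\<lambda>i::'i. euclidean) UNIV) (PiE UNIV K)"
    using assms by (simp add: compactin_PiE)
  then show ?thesis by (simp add: euclidean_product_topology PiE_UNIV_domain Pi_def)
qed

text \<open>Zorn's lemma on complements. Finite subfamilies of a chain have a least member, so
  compactness makes the intersection of the chain nonempty, which is the proviso in
  \<open>Inter\<close>. It serves closed subsemigroups and closed left ideals alike.\<close>

lemma compact_minimal_member:
  fixes E :: "'s::t2_space set"
  assumes "compact E" "A0 \<in> F"
    and F: "\<And>A. A \<in> F \<Longrightarrow> closed A \<and> A \<noteq> {} \<and> A \<subseteq> E"
    and Inter: "\<And>C. C \<noteq> {} \<Longrightarrow> C \<subseteq> F \<Longrightarrow> \<Inter>C \<noteq> {} \<Longrightarrow> \<Inter>C \<in> F"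
  shows "\<exists>M\<in>F. \<forall>A\<in>F. A \<subseteq> M \<longrightarrow> A = M"
proof -
  have "\<exists>M\<in>uminus ` F. \<forall>X\<in>uminus ` F. M \<subseteq> X \<longrightarrow> X = M"
  proof (rule subset_Zorn_nonempty)
    fix C assume C: "C \<noteq> {}" "subset.chain (uminus ` F) C"
    define D where "D = uminus ` C"
    have DF: "D \<subseteq> F" and Dne: "D \<noteq> {}"
      using C unfolding D_def subset.chain_def by auto
    have chain: "A \<subseteq> B \<or> B \<subseteq> A" if AB: "A \<in> D" "B \<in> D" for A B
    proof -
      have "- A \<in> C" "- B \<in> C" using AB by (auto simp: D_def)
      then have "- A \<subseteq> - B \<or> - B \<subseteq> - A" using C(2) unfolding subset_chain_def by blast
      then show ?thesis by auto
    qed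
    have min: "\<exists>A\<in>D. A \<subseteq> \<Inter>G" if "finite G" "G \<subseteq> D" for G
      using that
    proof (induction G rule: finite_induct)
      case empty
      then show ?case using Dne by auto
    next
      case (insert B G)
      then obtain A where A: "A \<in> D" "A \<subseteq> \<Inter>G" by blast
      have B: "B \<in> D" using insert.prems by simp
      show ?case
      proof (cases "A \<subseteq> B")
        case True
        then show ?thesis using A by (intro bexI[of _ A]) simp_all
      next
        case False
        then have "B \<subseteq> A" using chain[OF A(1) B] by blast
        then show ?thesis using A(2) B by (intro bexI[of _ B]) (simp_all add: subset_trans)
      qed
    qed
    have "E \<inter> \<Inter>D \<noteq> {}"
    proof (rule compact_imp_fip[OF \<open>compact E\<close>])
      show "closed A" if "A \<in> D" for A using that DF F by auto
      show "E \<inter> \<Inter>G \<noteq> {}" if G: "finite G" "G \<subseteq> D" for G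
      proof -
        obtain A where "A \<in> D" "A \<subseteq> \<Inter>G" using min[OF G] by auto
        moreover have "A \<noteq> {}" "A \<subseteq> E" using F[of A] \<open>A \<in> D\<close> DF by auto
        ultimately show ?thesis by blast
      qed
    qed
    then have "\<Inter>D \<in> F" by (intro Inter Dne DF) auto
    moreover have "\<Union>C = - \<Inter>D" by (auto simp: D_def)
    ultimately show "\<Union>C \<in> uminus ` F" by (intro image_eqI)
  qed (use \<open>A0 \<in> F\<close> in auto)
  then show ?thesis by simp
qed

section \<open>Idempotents and minimal left ideals\<close>

text \<open>Continuity is assumed in the left factor only: composition of discontinuous limit maps
  is pointwise continuous in the outer map, not in the inner one.\<close>

locale compact_semigroup =
  fixes E :: "'s::t2_space set" and mult :: "'s \<Rightarrow> 's \<Rightarrow> 's" (infixl "\<odot>" 70)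
  assumes compact_E: "compact E" and nonempty_E: "E \<noteq> {}"
    and mult_closed [intro, simp]: "p \<in> E \<Longrightarrow> q \<in> E \<Longrightarrow> p \<odot> q \<in> E"
    and assoc: "p \<in> E \<Longrightarrow> q \<in> E \<Longrightarrow> r \<in> E \<Longrightarrow> p \<odot> q \<odot> r = p \<odot> (q \<odot> r)"
    and right_continuous: "q \<in> E \<Longrightarrow> continuous_on E (\<lambda>p. p \<odot> q)"
begin

lemma subsemigroup:
  assumes "closed L" "L \<noteq> {}" "L \<subseteq> E" "\<And>p q. p \<in> L \<Longrightarrow> q \<in> L \<Longrightarrow> p \<odot> q \<in> L"
  shows "compact_semigroup L (\<odot>)"
proof
  show "compact L" using compact_E assms by (metis closed_Int_compact inf.absorb1)
  show "continuous_on L (\<lambda>p. p \<odot> q)" if "q \<in> L" for q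
    using continuous_on_subset[OF right_continuous] assms that by blast
qed (use assms assoc in \<open>auto simp: subset_iff\<close>)

lemma closed_translate: 
  assumes "compact L" "L \<subseteq> E" "q \<in> E"
  shows "closed ((\<lambda>p. p \<odot> q) ` L)"
  using compact_continuous_image[OF continuous_on_subset[OF right_continuous[OF assms(3)] assms(2)] assms(1)]
  by (rule compact_imp_closed)

lemma closed_stabilizer:
  assumes "closed L" "L \<subseteq> E" "q \<in> E"
  shows "closed {p \<in> L. p \<odot> q = r}"
  using continuous_closed_preimage_constant[OF continuous_on_subset[OF right_continuous[OF assms(3)] assms(2)] assms(1)] .

text \<open>The Ellis-Numakura lemma. For \<open>e\<close> in a minimal closed subsemigroup
  \<open>M\<close>, minimality gives \<open>M \<odot> e = M\<close>, so some element of
  \<open>M\<close> stabilizes \<open>e\<close>; the stabilizer is again a closed subsemigroup, hence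
  all of \<open>M\<close>, and contains \<open>e\<close>.\<close>

theorem idempotent_exists: obtains e where "e \<in> E" "e \<odot> e = e"
proof -
  define F where "F = {L. closed L \<and> L \<noteq> {} \<and> L \<subseteq> E \<and> (\<forall>p\<in>L. \<forall>q\<in>L. p \<odot> q \<in> L)}"
  have EF: "E \<in> F" unfolding F_def using nonempty_E compact_imp_closed[OF compact_E] by auto
  have Int: "\<Inter>C \<in> F" if "C \<noteq> {}" "C \<subseteq> F" "\<Inter>C \<noteq> {}" for C
    using that unfolding F_def by (auto simp: subset_iff Ball_def) 
  have FE: "closed A \<and> A \<noteq> {} \<and> A \<subseteq> E" if "A \<in> F" for A
    using that unfolding F_def by blast
  have "\<exists>M\<in>F. \<forall>A\<in>F. A \<subseteq> M \<longrightarrow> A = M"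
    by (rule compact_minimal_member[OF compact_E EF FE Int])
  then obtain M where M: "M \<in> F" and min: "\<And>A. A \<in> F \<Longrightarrow> A \<subseteq> M \<Longrightarrow> A = M" by blast
  then have clM: "closed M" and ME: "M \<subseteq> E" and MM: "\<And>p q. p \<in> M \<Longrightarrow> q \<in> M \<Longrightarrow> p \<odot> q \<in> M"
    and "M \<noteq> {}"
    unfolding F_def by auto
  then obtain e where e: "e \<in> M" by auto
  have coM: "compact M" using compact_E clM ME by (metis closed_Int_compact inf.absorb1)
  have sub: "(\<lambda>p. p \<odot> e) ` M \<subseteq> M" using e MM by blast
  have "(\<lambda>p. p \<odot> e) ` M = M"
  proof (rule min)
    have *: "p \<odot> e \<odot> (q \<odot> e) \<in> (\<lambda>p. p \<odot> e) ` M" if "p \<in> M" "q \<in> M" for p q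
    proof -
      have "p \<odot> e \<odot> (q \<odot> e) = (p \<odot> e \<odot> q) \<odot> e"
        using that e ME by (simp add: assoc subset_iff)
      then show ?thesis using that e MM by blast
    qed
    then show "(\<lambda>p. p \<odot> e) ` M \<in> F" unfolding F_def
      using closed_translate[OF coM ME subsetD[OF ME e]] \<open>M \<noteq> {}\<close> order.trans[OF sub ME] by blast
  qed (use sub in auto)
  then obtain p where p: "p \<in> M" "p \<odot> e = e" using e by (metis imageE)
  have "{p \<in> M. p \<odot> e = e} = M"
  proof (rule min)
    have "p \<odot> q \<odot> e = e" if "p \<in> M" "q \<in> M" "p \<odot> e = e" "q \<odot> e = e" for p q
      using that e ME by (simp add: assoc subset_iff)
    moreover have "closed {p \<in> M. p \<odot> e = e}" using e ME by (intro closed_stabilizer clM) auto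
    ultimately show "{p \<in> M. p \<odot> e = e} \<in> F" unfolding F_def
      using p ME MM by blast
  qed auto
  then have "e \<odot> e = e" using e by blast
  then show thesis using that[of e] e ME by blast
qed

text \<open>The last conjunct says that the left ideal \<open>E \<odot> u\<close> is minimal,
  without mentioning ideals: every \<open>E \<odot> (p \<odot> u)\<close> inside it still reaches
  \<open>u\<close>.\<close>

definition minimal_idem :: "'s \<Rightarrow> bool" where
  "minimal_idem u \<longleftrightarrow> u \<in> E \<and> u \<odot> u = u \<and> (\<forall>p\<in>E. \<exists>q\<in>E. q \<odot> (p \<odot> u) = u)"

text \<open>Every idempotent of a minimal closed left ideal inside \<open>E \<odot> a\<close> is minimal.\<close>

theorem minimal_idem_exists:
  assumes a: "a \<in> E"
  obtains u p where "minimal_idem u" "p \<in> E" "u = p \<odot> a"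
proof -
  define F where "F = {L. closed L \<and> L \<noteq> {} \<and> L \<subseteq> (\<lambda>p. p \<odot> a) ` E \<and> (\<forall>p\<in>E. \<forall>q\<in>L. p \<odot> q \<in> L)}"
  have FI: "L \<in> F" if "closed L" "L \<noteq> {}" "L \<subseteq> (\<lambda>p. p \<odot> a) ` E" "\<And>p q. p \<in> E \<Longrightarrow> q \<in> L \<Longrightarrow> p \<odot> q \<in> L" for L
    using that by (simp add: F_def)
  have FD: "closed L" "L \<noteq> {}" "L \<subseteq> (\<lambda>p. p \<odot> a) ` E" "\<And>p q. p \<in> E \<Longrightarrow> q \<in> L \<Longrightarrow> p \<odot> q \<in> L"
    if "L \<in> F" for L
    using that by (simp_all add: F_def)
  have sub: "(\<lambda>p. p \<odot> a) ` E \<subseteq> E" using a by auto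
  have principal: "(\<lambda>p. p \<odot> b) ` E \<in> F" if b: "b \<in> E" "(\<lambda>p. p \<odot> b) ` E \<subseteq> (\<lambda>p. p \<odot> a) ` E" for b
  proof (rule FI)
    show "closed ((\<lambda>p. p \<odot> b) ` E)" by (rule closed_translate[OF compact_E subset_refl b(1)])
    show "p \<odot> q \<in> (\<lambda>p. p \<odot> b) ` E" if p: "p \<in> E" and q: "q \<in> (\<lambda>p. p \<odot> b) ` E" for p q
    proof -
      obtain r where r: "r \<in> E" "q = r \<odot> b" using q by auto
      have "p \<odot> q = p \<odot> r \<odot> b" using assoc[OF p r(1) b(1)] r(2) by simp
      then show ?thesis using p r(1) by (intro image_eqI[of _ _ "p \<odot> r"]) auto
    qed
  qed (use nonempty_E b in auto)
  have Int: "\<Inter>C \<in> F" if C: "C \<noteq> {}" "C \<subseteq> F" "\<Inter>C \<noteq> {}" for C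
  proof (rule FI)
    show "closed (\<Inter>C)" using FD(1) C(2) by (intro closed_Inter) auto
    obtain B where B: "B \<in> C" using C(1) by auto
    then have "\<Inter>C \<subseteq> B" by (rule Inter_lower)
    also have "B \<subseteq> (\<lambda>p. p \<odot> a) ` E" using B C(2) by (intro FD(3)) auto
    finally show "\<Inter>C \<subseteq> (\<lambda>p. p \<odot> a) ` E" .
    show "p \<odot> q \<in> \<Inter>C" if "p \<in> E" "q \<in> \<Inter>C" for p q
    proof (rule InterI)
      fix B assume "B \<in> C"
      then show "p \<odot> q \<in> B" using that C(2) by (intro FD(4)) auto
    qed
  qed (rule C(3))
  have FE: "closed A \<and> A \<noteq> {} \<and> A \<subseteq> E" if "A \<in> F" for A
    using FD(1-3)[OF that] sub by (metis order.trans)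
  have "\<exists>M\<in>F. \<forall>A\<in>F. A \<subseteq> M \<longrightarrow> A = M"
    by (rule compact_minimal_member[OF compact_E principal[OF a subset_refl] FE Int])
  then obtain M where M: "M \<in> F" and min: "\<And>A. A \<in> F \<Longrightarrow> A \<subseteq> M \<Longrightarrow> A = M" by blast
  have ME: "M \<subseteq> E" using FE[OF M] by simp
  interpret M: compact_semigroup M "(\<odot>)"
    using FD[OF M] ME by (intro subsemigroup) (auto simp: subset_iff)
  obtain u where u: "u \<in> M" "u \<odot> u = u" using M.idempotent_exists by auto
  have uE: "u \<in> E" using u ME by auto
  have "\<exists>q\<in>E. q \<odot> (p \<odot> u) = u" if p: "p \<in> E" for p
  proof -
    have pu: "p \<odot> u \<in> M" "p \<odot> u \<in> E" using FD(4)[OF M p u(1)] p uE by auto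
    have sub': "(\<lambda>q. q \<odot> (p \<odot> u)) ` E \<subseteq> M" using FD(4)[OF M _ pu(1)] by auto
    then have "(\<lambda>q. q \<odot> (p \<odot> u)) ` E = M"
      using FD(3)[OF M] by (intro min principal pu) auto
    then show ?thesis using u by (metis imageE)
  qed
  then have "minimal_idem u" unfolding minimal_idem_def using u uE by auto
  moreover obtain p where "p \<in> E" "u = p \<odot> a" using FD(3)[OF M] u(1) by auto
  ultimately show thesis by (rule that)
qed

lemma minimal_idemD:
  assumes "minimal_idem u" shows "u \<in> E" "u \<odot> u = u"
  using assms unfolding minimal_idem_def by auto

text \<open>Since \<open>f \<odot> u = f\<close>, minimality yields \<open>q\<close> with
  \<open>q \<odot> f = u\<close>; multiplying \<open>q\<close> by \<open>u\<close> on both sides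
  moves it into \<open>u \<odot> E \<odot> u\<close> and keeps this product.\<close>

lemma minimal_idem_left_inverse:
  assumes u: "minimal_idem u" and f: "f \<in> E" "u \<odot> f = f" "f \<odot> u = f"
  obtains g where "g \<in> E" "u \<odot> g = g" "g \<odot> u = g" "g \<odot> f = u"
proof -
  note uE = minimal_idemD[OF u]
  obtain q where q: "q \<in> E" "q \<odot> (f \<odot> u) = u" using u f unfolding minimal_idem_def by auto
  show thesis
  proof (rule that[of "u \<odot> q \<odot> u"])
    have "u \<odot> q \<odot> u \<odot> f = u \<odot> (q \<odot> (f \<odot> u))" using f q(1) uE by (simp add: assoc)
    then show "u \<odot> q \<odot> u \<odot> f = u" using q uE by simp
    have "u \<odot> (u \<odot> r) = u \<odot> r" if "r \<in> E" for r
      using assoc[OF uE(1) uE(1) that] uE by simp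
    then show "u \<odot> (u \<odot> q \<odot> u) = u \<odot> q \<odot> u" using uE q(1) by (simp add: assoc)
  qed (use uE q(1) in \<open>auto simp: assoc\<close>)
qed

text \<open>\<open>u \<odot> E \<odot> u\<close> is a group with neutral element \<open>u\<close>.\<close>

lemma minimal_idem_inverse:
  assumes u: "minimal_idem u" and f: "f \<in> E" "u \<odot> f = f" "f \<odot> u = f"
  obtains g where "g \<in> E" "u \<odot> g = g" "g \<odot> u = g" "g \<odot> f = u" "f \<odot> g = u"
proof -
  obtain g where g: "g \<in> E" "u \<odot> g = g" "g \<odot> u = g" "g \<odot> f = u"
    using minimal_idem_left_inverse[OF u f] by blast
  obtain k where k: "k \<in> E" "u \<odot> k = k" "k \<odot> u = k" "k \<odot> g = u"
    using minimal_idem_left_inverse[OF u g(1-3)] by blast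
  \<comment> \<open>A left inverse of the left inverse \<open>g\<close> must be \<open>f\<close>
    itself, so \<open>g\<close> is two-sided.\<close>
  have "k = k \<odot> (g \<odot> f)" using k g by simp
  also have "\<dots> = k \<odot> g \<odot> f" using k(1) g(1) f(1) by (simp add: assoc)
  also have "\<dots> = f" using k f by simp
  finally show thesis using that g k by auto
qed

text \<open>\<open>v\<close> lies in the minimal left ideal of \<open>u\<close>, so
  \<open>v \<odot> u = v\<close> and minimality writes \<open>u\<close> as
  \<open>p \<odot> v\<close>; right multiplication by the idempotent \<open>v\<close> does not
  change that.\<close>

lemma minimal_idem_absorb:
  assumes u: "minimal_idem u" and v: "q \<in> E" "v = q \<odot> u" "v \<odot> v = v"
  shows "u \<odot> v = u"
proof -
  have vE: "v \<in> E" using minimal_idemD[OF u] v by auto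
  obtain p where p: "p \<in> E" "p \<odot> (v \<odot> u) = u" using u vE unfolding minimal_idem_def by auto
  have vu: "v \<odot> u = v" using v minimal_idemD[OF u] by (simp add: assoc)
  then have "u \<odot> v = p \<odot> v \<odot> v" using p by simp
  also have "\<dots> = p \<odot> v" using assoc[OF p(1) vE vE] v(3) by simp
  finally show ?thesis using p vu by simp
qed

end

section \<open>Semigroups of families of self-maps\<close>

definition fcomp :: "('i \<Rightarrow> 'a \<Rightarrow> 'a) \<Rightarrow> ('i \<Rightarrow> 'a \<Rightarrow> 'a) \<Rightarrow> 'i \<Rightarrow> 'a \<Rightarrow> 'a" where
  "fcomp f g = (\<lambda>i x. f i (g i x))"

text \<open>Forcing the identity off \<open>K\<close> makes this a full product of compact factors,
  \<open>K\<close> or a singleton, so that Tychonoff's theorem applies to total functions.\<close>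

definition selfmaps :: "'a set \<Rightarrow> ('i \<Rightarrow> 'a \<Rightarrow> 'a) set" where
  "selfmaps K = {f. \<forall>i x. f i x \<in> (if x \<in> K then K else {x})}"

lemma fcomp_apply [simp]: "fcomp f g i x = f i (g i x)"
  by (simp add: fcomp_def)

lemma fcomp_assoc: "fcomp (fcomp f g) h = fcomp f (fcomp g h)"
  by (simp add: fcomp_def)

lemma selfmaps_in: "f \<in> selfmaps K \<Longrightarrow> x \<in> K \<Longrightarrow> f i x \<in> K"
  unfolding selfmaps_def by (auto split: if_splits)

lemma selfmaps_out: "f \<in> selfmaps K \<Longrightarrow> x \<notin> K \<Longrightarrow> f i x = x"
  unfolding selfmaps_def by (metis (mono_tags, lifting) mem_Collect_eq singletonD)

lemma selfmapsI:
  "(\<And>i x. x \<in> K \<Longrightarrow> f i x \<in> K) \<Longrightarrow> (\<And>i x. x \<notin> K \<Longrightarrow> f i x = x) \<Longrightarrow> f \<in> selfmaps K"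
  unfolding selfmaps_def by auto

lemma compact_selfmaps:
  fixes K :: "'a::t2_space set"
  assumes "compact K" shows "compact (selfmaps K :: ('i \<Rightarrow> 'a \<Rightarrow> 'a) set)"
proof -
  have "compact {h. \<forall>x. h x \<in> (if x \<in> K then K else {x})}"
    using assms by (intro compact_Pi_UNIV) auto
  then have "compact {f::'i \<Rightarrow> 'a \<Rightarrow> 'a. \<forall>i. f i \<in> {h. \<forall>x. h x \<in> (if x \<in> K then K else {x})}}"
    by (rule compact_Pi_UNIV)
  then show ?thesis unfolding selfmaps_def by simp
qed

lemma continuous_on_eval: "continuous_on S (\<lambda>f::'i \<Rightarrow> 'a \<Rightarrow> 'b::topological_space. f i x)"
  by (rule continuous_on_product_then_coordinatewise)
     (rule continuous_on_subset[OF continuous_on_product_coordinates subset_UNIV])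

lemma continuous_on_fun2:
  fixes F :: "'s::topological_space \<Rightarrow> 'i \<Rightarrow> 'a \<Rightarrow> 'b::topological_space"
  assumes "\<And>i x. continuous_on S (\<lambda>s. F s i x)" shows "continuous_on S F"
  using assms by (intro continuous_on_coordinatewise_then_product)

lemma continuous_on_fcomp_left: "continuous_on S (\<lambda>f::'i \<Rightarrow> 'a::topological_space \<Rightarrow> 'a. fcomp f g)"
  by (intro continuous_on_fun2) (simp add: continuous_on_eval)

lemma continuous_on_fcomp_right:
  fixes a :: "'i \<Rightarrow> 'a::topological_space \<Rightarrow> 'a"
  assumes "\<And>i. continuous_on K (a i)"
  shows "continuous_on (selfmaps K) (fcomp a)"
proof (rule continuous_on_fun2)
  fix i x
  show "continuous_on (selfmaps K) (\<lambda>f. fcomp a f i x)"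
  proof (cases "x \<in> K")
    case True
    then have "continuous_on (selfmaps K) (\<lambda>f. a i (f i x))"
      by (intro continuous_on_compose2[OF assms[of i] continuous_on_eval]) (auto intro: selfmaps_in)
    then show ?thesis by simp
  next
    case False
    have "continuous_on (selfmaps K) (\<lambda>f. fcomp a f i x) \<longleftrightarrow> continuous_on (selfmaps K) (\<lambda>f::'i \<Rightarrow> 'a \<Rightarrow> 'a. a i x)"
      using False by (intro continuous_on_cong refl) (simp add: selfmaps_out)
    then show ?thesis by simp
  qed
qed

lemma closure_selfmaps:
  fixes K :: "'a::t2_space set"
  assumes "compact K" "A \<subseteq> selfmaps K" shows "closure A \<subseteq> selfmaps K"
  using assms(2) compact_imp_closed[OF compact_selfmaps[OF assms(1)]] by (rule closure_minimal)

text \<open>Composition is not jointly continuous, so the limits are taken one factor at a time: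
  first in \<open>q\<close>, with a continuous generator \<open>a\<close> outside, then in
  \<open>p\<close>, with the limit \<open>q\<close> held fixed.\<close>

lemma closure_fcomp_closed:
  fixes K :: "'a::t2_space set" and A :: "('i \<Rightarrow> 'a \<Rightarrow> 'a) set"
  assumes K: "compact K" and A: "A \<subseteq> selfmaps K"
    and cont: "\<And>a i. a \<in> A \<Longrightarrow> continuous_on K (a i)"
    and B: "B \<subseteq> selfmaps K" and AB: "\<And>a b. a \<in> A \<Longrightarrow> b \<in> B \<Longrightarrow> fcomp a b \<in> closure C"
    and pq: "p \<in> closure A" "q \<in> closure B"
  shows "fcomp p q \<in> closure C"
proof -
  have "fcomp a ` closure B \<subseteq> closure C" if "a \<in> A" for a
    using that AB closure_selfmaps[OF K B]
    by (intro image_closure_subset continuous_on_subset[OF continuous_on_fcomp_right[OF cont]]) auto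
  then have "(\<lambda>p. fcomp p q) ` closure A \<subseteq> closure C"
    using pq(2) by (intro image_closure_subset continuous_on_fcomp_left) auto
  then show ?thesis using pq by auto
qed

lemma compact_semigroup_closure:
  fixes K :: "'a::t2_space set" and A :: "('i \<Rightarrow> 'a \<Rightarrow> 'a) set"
  assumes K: "compact K" and A: "A \<subseteq> selfmaps K" "A \<noteq> {}"
    and cont: "\<And>a i. a \<in> A \<Longrightarrow> continuous_on K (a i)"
    and AA: "\<And>a b. a \<in> A \<Longrightarrow> b \<in> A \<Longrightarrow> fcomp a b \<in> A"
  shows "compact_semigroup (closure A) fcomp"
proof
  show "compact (closure A)"
    using compact_Int_closed[OF compact_selfmaps[OF K] closed_closure[of A]] closure_selfmaps[OF K A(1)]
    by (simp add: inf.absorb2)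
  show "fcomp p q \<in> closure A" if "p \<in> closure A" "q \<in> closure A" for p q
  proof (rule closure_fcomp_closed[OF K A(1) _ A(1) _ that])
    show "fcomp a b \<in> closure A" if "a \<in> A" "b \<in> A" for a b
      using AA[OF that] closure_subset by (rule subsetD[rotated])
  qed (rule cont)
qed (use A continuous_on_fcomp_left in \<open>auto simp: fcomp_assoc\<close>)

lemma closure_approx:
  assumes "f \<in> closure A" "open W" "f \<in> W" obtains a where "a \<in> A" "a \<in> W"
  using assms open_Int_closure_eq_empty[of W A] by blast

lemma open_eval_vimage:
  fixes V :: "'b::topological_space set"
  assumes "open V" shows "open {f::'i \<Rightarrow> 'a \<Rightarrow> 'b. f i x \<in> V}"
  using open_vimage[OF assms continuous_on_eval[of UNIV i x]] by (simp add: vimage_def)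

section \<open>Folkman's theorem on finite unions\<close>

definition disjoint_blocks :: "nat \<Rightarrow> (nat \<Rightarrow> nat set) \<Rightarrow> bool" where
  "disjoint_blocks l D \<longleftrightarrow> (\<forall>i<l. finite (D i) \<and> D i \<noteq> {}) \<and> disjoint_family_on D {..<l}"

definition monochromatic_unions :: "(nat set \<Rightarrow> nat) \<Rightarrow> nat \<Rightarrow> (nat \<Rightarrow> nat set) \<Rightarrow> bool" where
  "monochromatic_unions \<kappa> l D \<longleftrightarrow> (\<exists>c. \<forall>E\<subseteq>{..<l}. E \<noteq> {} \<longrightarrow> \<kappa> (\<Union>(D ` E)) = c)"

text \<open>The \<open>unit\<close> index only fits the shifts into the families composed by
  \<open>fcomp\<close>. Functions that are not \<open>r\<close>-colourings are left alone, as
  \<open>selfmaps\<close> demands.\<close>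

definition colour_shift :: "nat \<Rightarrow> nat set \<Rightarrow> unit \<Rightarrow> (nat set \<Rightarrow> nat) \<Rightarrow> nat set \<Rightarrow> nat" where
  "colour_shift r s = (\<lambda>_ \<kappa>. if \<forall>t. \<kappa> t < r then (\<lambda>t. \<kappa> (s \<union> t)) else \<kappa>)"

text \<open>An idempotent \<open>p\<close> in the closure of the shifts by finite sets arbitrarily far out turns \<open>\<kappa>\<close>
  into a colouring \<open>\<psi>\<close> with \<open>p \<psi> = \<psi>\<close>; blocks are then chosen one by one so that \<open>\<kappa>\<close> and \<open>\<psi>\<close> both
  take the value \<open>\<psi> {}\<close> on all unions.\<close>

lemma monochromatic_unions_exist:
  assumes \<kappa>: "\<And>s. \<kappa> s < r"
  shows "\<exists>D. disjoint_blocks l D \<and> monochromatic_unions \<kappa> l D"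
proof -
  define K :: "(nat set \<Rightarrow> nat) set" where "K = {\<kappa>. \<forall>s. \<kappa> s \<in> {..<r}}"
  have K: "compact K" unfolding K_def by (intro compact_Pi_UNIV finite_imp_compact) auto
  have inK: "\<kappa>' \<in> K \<longleftrightarrow> (\<forall>t. \<kappa>' t < r)" for \<kappa>' by (simp add: K_def)
  define A where "A n = {colour_shift r s |s. finite s \<and> s \<noteq> {} \<and> s \<subseteq> {n..}}" for n
  have shiftK: "colour_shift r s u \<kappa>' = (\<lambda>t. \<kappa>' (s \<union> t))" if "\<kappa>' \<in> K" for s u \<kappa>'
    using that by (simp add: colour_shift_def inK)
  have AK: "A n \<subseteq> selfmaps K" for n
  proof
    fix a assume "a \<in> A n"
    then obtain s where s: "a = colour_shift r s" by (auto simp: A_def)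
    show "a \<in> selfmaps K"
    proof (rule selfmapsI)
      show "a i x \<in> K" if "x \<in> K" for i x using that by (simp add: s shiftK inK)
      show "a i x = x" if "x \<notin> K" for i x using that by (simp only: s colour_shift_def inK if_False)
    qed
  qed
  have "colour_shift r {n} \<in> A n" for n
    unfolding A_def by (intro CollectI exI[of _ "{n}"]) auto
  then have Ane: "A n \<noteq> {}" for n by auto
  have cont: "continuous_on K (a i)" if a: "a \<in> A n" for a i n
  proof -
    obtain s where s: "a = colour_shift r s" using a by (auto simp: A_def)
    have "continuous_on K (\<lambda>\<kappa>' t. \<kappa>' (s \<union> t))"
      by (intro continuous_on_coordinatewise_then_product
          continuous_on_subset[OF continuous_on_product_coordinates subset_UNIV])
    moreover have "continuous_on K (a i) \<longleftrightarrow> continuous_on K (\<lambda>\<kappa>' t. \<kappa>' (s \<union> t))"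
      by (intro continuous_on_cong refl) (simp add: s shiftK)
    ultimately show ?thesis by simp
  qed
  have AA: "fcomp a b \<in> A n" if ab: "a \<in> A n" "b \<in> A n" for a b n
  proof -
    obtain s t where st: "a = colour_shift r s" "finite s" "s \<noteq> {}" "s \<subseteq> {n..}"
      "b = colour_shift r t" "finite t" "t \<noteq> {}" "t \<subseteq> {n..}"
      using ab by (auto simp: A_def)
    have "fcomp a b = colour_shift r (t \<union> s)"
      by (auto simp: fun_eq_iff st fcomp_def colour_shift_def Un_assoc Un_left_commute)
    then show ?thesis unfolding A_def using st by (intro CollectI exI[of _ "t \<union> s"]) auto
  qed
  have sg: "compact_semigroup (closure (A n)) fcomp" for n
    by (rule compact_semigroup_closure[OF K AK Ane]) (erule cont, erule (1) AA)
  \<comment> \<open>Lying in every \<open>closure (A n)\<close> lets the next block be chosen beyond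
    all earlier ones, hence disjoint from them.\<close>
  define P where "P = (\<Inter>n. closure (A n))"
  have decr: "closure (A m) \<subseteq> closure (A n)" if "n \<le> m" for m n
  proof (intro closure_mono subsetI)
    fix a assume "a \<in> A m"
    then obtain s where s: "a = colour_shift r s" "finite s" "s \<noteq> {}" "s \<subseteq> {m..}" by (auto simp: A_def)
    have "s \<subseteq> {n..}" using s(4) that by auto
    then show "a \<in> A n" unfolding A_def using s by (intro CollectI exI[of _ s]) simp
  qed
  have "closure (A 0) \<inter> P \<noteq> {}" unfolding P_def
  proof (rule compact_imp_fip_image)
    show "compact (closure (A 0))" by (rule compact_semigroup.compact_E[OF sg])
    show "closure (A 0) \<inter> (\<Inter>n\<in>N. closure (A n)) \<noteq> {}" if "finite N" for N
    proof -
      obtain m where m: "\<forall>n\<in>N. n \<le> m" using \<open>finite N\<close> finite_nat_set_iff_bounded_le by blast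
      have "closure (A m) \<noteq> {}" using Ane[of m] by simp
      moreover have "closure (A m) \<subseteq> closure (A 0) \<inter> (\<Inter>n\<in>N. closure (A n))"
        using decr m by (intro Int_greatest INF_greatest) auto
      ultimately show ?thesis by (metis subset_empty)
    qed
  qed auto
  then have "P \<noteq> {}" by auto
  then have "compact_semigroup P fcomp"
    using compact_semigroup.mult_closed[OF sg]
    by (intro compact_semigroup.subsemigroup[OF sg[of 0]]) (auto simp: P_def)
  then obtain p where p: "p \<in> P" "fcomp p p = p"
    by (elim compact_semigroup.idempotent_exists)
  have pself: "p \<in> selfmaps K" using p(1) closure_selfmaps[OF K AK[of 0]] by (simp add: P_def subset_iff)
  have \<kappa>K: "\<kappa> \<in> K" using \<kappa> inK by auto
  define \<psi> where "\<psi> = p () \<kappa>"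
  have \<psi>K: "\<psi> \<in> K" unfolding \<psi>_def using selfmaps_in[OF pself \<kappa>K] .
  have p\<psi>: "p () \<psi> = \<psi>" unfolding \<psi>_def using p(2) by (metis fcomp_apply)
  have "\<exists>D. disjoint_blocks l D \<and> (\<forall>E\<subseteq>{..<l}. E \<noteq> {} \<longrightarrow> \<kappa> (\<Union>(D ` E)) = \<psi> {})
     \<and> (\<forall>E\<subseteq>{..<l}. \<psi> (\<Union>(D ` E)) = \<psi> {})"
  proof (induction l)
    case 0
    show ?case by (auto simp: disjoint_blocks_def disjoint_family_on_def)
  next
    case (Suc l)
    then obtain D where D: "disjoint_blocks l D"
      and D\<kappa>: "\<And>E. E \<subseteq> {..<l} \<Longrightarrow> E \<noteq> {} \<Longrightarrow> \<kappa> (\<Union>(D ` E)) = \<psi> {}"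
      and D\<psi>: "\<And>E. E \<subseteq> {..<l} \<Longrightarrow> \<psi> (\<Union>(D ` E)) = \<psi> {}" by auto
    have "finite (\<Union>(D ` {..<l}))" using D by (auto simp: disjoint_blocks_def)
    then obtain n where n: "\<Union>(D ` {..<l}) \<subseteq> {..<n}" using finite_nat_iff_bounded by blast
    \<comment> \<open>Since \<open>p\<close> sends both \<open>\<kappa>\<close> and
      \<open>\<psi>\<close> to \<open>\<psi>\<close>, a shift by \<open>s\<close> close to
      \<open>p\<close> makes both agree with \<open>\<psi>\<close> at the finitely many old unions.
      The case \<open>E = {}\<close> controls the new block alone.\<close>
    define W where "W = (\<Inter>E\<in>Pow {..<l}. {h. h () \<kappa> \<in> {\<phi>. \<phi> (\<Union>(D ` E)) \<in> {\<psi> (\<Union>(D ` E))}}}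
       \<inter> {h. h () \<psi> \<in> {\<phi>. \<phi> (\<Union>(D ` E)) \<in> {\<psi> (\<Union>(D ` E))}}})"
    have "open {\<phi>::nat set \<Rightarrow> nat. \<phi> t \<in> {c}}" for t c
      using open_coord_vimage[of "{c}" t] by (simp add: vimage_def open_discrete)
    then have "open W" unfolding W_def
      by (intro open_INT open_Int open_eval_vimage ballI) simp_all
    moreover have "p \<in> W" unfolding W_def using p\<psi> \<psi>_def by simp
    moreover have "p \<in> closure (A n)" using p(1) by (simp add: P_def)
    ultimately obtain s where s: "finite s" "s \<noteq> {}" "s \<subseteq> {n..}" "colour_shift r s \<in> W"
      by (elim closure_approx) (auto simp: A_def)
    have s\<kappa>: "\<kappa> (s \<union> \<Union>(D ` E)) = \<psi> {}" "\<psi> (s \<union> \<Union>(D ` E)) = \<psi> {}" if "E \<subseteq> {..<l}" for E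
      using s(4) that D\<psi>[OF that] by (simp_all add: W_def shiftK[OF \<kappa>K] shiftK[OF \<psi>K])
    define D' where "D' = D(l := s)"
    have disj: "D i \<inter> s = {}" if "i < l" for i 
    proof -
      have "D i \<subseteq> {..<n}" using n that by blast
      then show ?thesis using s(3) by force
    qed
    have "D' i \<inter> D' j = {}" if "i < Suc l" "j < Suc l" "i \<noteq> j" for i j
    proof (cases "i = l \<or> j = l")
      case True
      then show ?thesis using disj[of i] disj[of j] that by (auto simp: D'_def)
    next
      case False
      then have "D i \<inter> D j = {}"
        using D that by (simp add: disjoint_blocks_def disjoint_family_on_def)
      then show ?thesis using False by (simp add: D'_def)
    qed
    then have blk: "disjoint_blocks (Suc l) D'"
      using D s(1,2) by (simp add: D'_def disjoint_blocks_def disjoint_family_on_def)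
    have D'E: "\<Union>(D' ` E) = \<Union>(D ` E)" if "l \<notin> E" for E
      using that unfolding D'_def by (intro SUP_cong) auto
    have D'E': "\<Union>(D' ` E) = s \<union> \<Union>(D ` (E - {l}))" if "l \<in> E" for E
    proof -
      have "\<Union>(D' ` (E - {l})) = \<Union>(D ` (E - {l}))" by (rule D'E) simp
      moreover have "E = insert l (E - {l})" using that by auto
      then have "\<Union>(D' ` E) = D' l \<union> \<Union>(D' ` (E - {l}))" by (metis UN_insert)
      ultimately show ?thesis by (simp add: D'_def)
    qed
    have sub: "E - {l} \<subseteq> {..<l}" "l \<notin> E \<Longrightarrow> E \<subseteq> {..<l}" if "E \<subseteq> {..<Suc l}" for E
      using that by (auto simp: less_Suc_eq)
    have "\<kappa> (\<Union>(D' ` E)) = \<psi> {}" if "E \<subseteq> {..<Suc l}" "E \<noteq> {}" for E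
      using s\<kappa>(1)[OF sub(1)] D\<kappa>[OF sub(2)] D'E D'E' that by metis
    moreover have "\<psi> (\<Union>(D' ` E)) = \<psi> {}" if "E \<subseteq> {..<Suc l}" for E
      using s\<kappa>(2)[OF sub(1)] D\<psi>[OF sub(2)] D'E D'E' that by metis
    ultimately show ?case using blk by blast
  qed
  then show ?thesis unfolding monochromatic_unions_def by blast
qed

text \<open>Compactness makes the bound uniform over all colourings: the sets \<open>bad L\<close>
  of colourings without a solution inside \<open>{..<L}\<close> are closed and decreasing, so if
  each met \<open>K\<close>, a single colouring would have no solution at all.\<close>

theorem folkman:
  obtains L where "\<And>\<kappa>. (\<And>s. \<kappa> s < r) \<Longrightarrow>
    \<exists>D. disjoint_blocks l D \<and> \<Union>(D ` {..<l}) \<subseteq> {..<L} \<and> monochromatic_unions \<kappa> l D"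
proof -
  define K :: "(nat set \<Rightarrow> nat) set" where "K = {\<kappa>. \<forall>s. \<kappa> s \<in> {..<r}}"
  have K: "compact K" unfolding K_def by (intro compact_Pi_UNIV finite_imp_compact) auto
  define \<D> where "\<D> L = {D. disjoint_blocks l D \<and> \<Union>(D ` {..<l}) \<subseteq> {..<L}}" for L
  define bad where "bad L = (\<Inter>D\<in>\<D> L. - {\<kappa>. monochromatic_unions \<kappa> l D})" for L
  have "\<exists>L. K \<inter> bad L = {}"
  proof (rule ccontr)
    assume nex: "\<nexists>L. K \<inter> bad L = {}"
    have "open {\<kappa>. monochromatic_unions \<kappa> l D}" for D
    proof -
      have "open ((\<lambda>\<kappa>::nat set \<Rightarrow> nat. \<kappa> t) -` {c})" for t c
        by (intro open_coord_vimage open_discrete)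
      then have "open (\<Union>c. \<Inter>E\<in>{E \<in> Pow {..<l}. E \<noteq> {}}. (\<lambda>\<kappa>::nat set \<Rightarrow> nat. \<kappa> (\<Union>(D ` E))) -` {c})"
        by (intro open_UN open_INT ballI) auto
      also have "\<dots> = {\<kappa>. monochromatic_unions \<kappa> l D}"
        unfolding monochromatic_unions_def by auto
      finally show ?thesis .
    qed
    then have closed: "closed (bad L)" for L
      unfolding bad_def by (intro closed_INT ballI) (simp add: closed_Compl)
    have mono: "bad m \<subseteq> bad n" if "n \<le> m" for m n
      using that unfolding bad_def \<D>_def by fastforce
    have "K \<inter> (\<Inter>L. bad L) \<noteq> {}"
    proof (rule compact_imp_fip_image[OF K closed])
      show "K \<inter> (\<Inter>n\<in>N. bad n) \<noteq> {}" if "finite N" for N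
      proof -
        obtain m where m: "\<forall>n\<in>N. n \<le> m" using \<open>finite N\<close> finite_nat_set_iff_bounded_le by blast
        then have "bad m \<subseteq> (\<Inter>n\<in>N. bad n)" using mono by blast
        then show ?thesis using nex by blast
      qed
    qed
    then obtain \<kappa> where \<kappa>: "\<And>s. \<kappa> s < r" "\<And>L. \<kappa> \<in> bad L" by (auto simp: K_def)
    obtain D where D: "disjoint_blocks l D" "monochromatic_unions \<kappa> l D"
      using monochromatic_unions_exist[of \<kappa> r l] \<kappa>(1) by blast
    have "finite (\<Union>(D ` {..<l}))" using D(1) by (auto simp: disjoint_blocks_def)
    then obtain n where "\<Union>(D ` {..<l}) \<subseteq> {..<n}" using finite_nat_iff_bounded by blast
    then have "D \<in> \<D> n" using D unfolding \<D>_def by auto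
    then show False using \<kappa>(2)[of n] D(2) unfolding bad_def by auto
  qed
  then obtain L where L: "K \<inter> bad L = {}" by blast
  have "\<exists>D. disjoint_blocks l D \<and> \<Union>(D ` {..<l}) \<subseteq> {..<L} \<and> monochromatic_unions \<kappa> l D"
    if "\<And>s. \<kappa> s < r" for \<kappa>
  proof -
    have "\<kappa> \<in> K" using that by (simp add: K_def)
    then have "\<kappa> \<notin> bad L" using L by blast
    then show ?thesis unfolding bad_def \<D>_def by blast
  qed
  then show thesis by (rule that)
qed

section \<open>The cube and face semigroups of a minimal flow\<close>

notation fcomp (infixl "\<star>" 70)

text \<open>\<open>cube_sum d n E\<close> is the exponent at the vertex \<open>E \<inter> {..<d}\<close> of the cube with edges \<open>n\<close>; vertices are
  represented by arbitrary sets of naturals.\<close>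

definition cube_sum :: "nat \<Rightarrow> (nat \<Rightarrow> int) \<Rightarrow> nat set \<Rightarrow> int" where
  "cube_sum d n E = (\<Sum>i<d. if i \<in> E then n i else 0)"

lemma cube_sum_Suc: "cube_sum (Suc d) n E = cube_sum d n E + (if d \<in> E then n d else 0)"
  by (simp add: cube_sum_def)

lemma cube_sum_0 [simp]: "cube_sum 0 n E = 0"
  by (simp add: cube_sum_def)

lemma cube_sum_cong:
  assumes "\<And>i. i < d \<Longrightarrow> n i = n' i" "\<And>i. i < d \<Longrightarrow> i \<in> E \<longleftrightarrow> i \<in> E'"
  shows "cube_sum d n E = cube_sum d n' E'"
  unfolding cube_sum_def using assms by (intro sum.cong) auto

lemma cube_sum_Int: "cube_sum d n (E \<inter> {..<d}) = cube_sum d n E"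
  by (rule cube_sum_cong) auto

lemma cube_sum_empty: "E \<inter> {..<d} = {} \<Longrightarrow> cube_sum d n E = 0"
  unfolding cube_sum_def by (intro sum.neutral) auto

lemma cube_sum_eq: "E \<subseteq> {..<d} \<Longrightarrow> cube_sum d n E = (\<Sum>i\<in>E. n i)"
  unfolding cube_sum_def by (simp add: sum.If_cases inf.absorb2)

lemma cube_sum_add: "cube_sum d n E + cube_sum d n' E = cube_sum d (\<lambda>i. n i + n' i) E"
  unfolding cube_sum_def by (simp add: sum.distrib[symmetric]) (intro sum.cong; simp)

text \<open>The origin is represented by every \<open>E\<close> that misses \<open>{..<d}\<close>.
  Face transformations are trivial there, so an element of the cube semigroup has to be altered at
  least in this way to become one of the face semigroup.\<close>

definition truncate :: "nat \<Rightarrow> (nat set \<Rightarrow> 'a \<Rightarrow> 'a) \<Rightarrow> nat set \<Rightarrow> 'a \<Rightarrow> 'a" where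
  "truncate d h = (\<lambda>E. if E \<inter> {..<d} = {} then (\<lambda>x. x) else h E)"

lemma truncate_empty: "E \<inter> {..<d} = {} \<Longrightarrow> truncate d h E = (\<lambda>x. x)"
  and truncate_nonempty: "E \<inter> {..<d} \<noteq> {} \<Longrightarrow> truncate d h E = h E"
  by (simp_all add: truncate_def)

text \<open>The action is the identity off \<open>X\<close>, so that its maps lie in
  \<open>selfmaps X\<close>. Density is asked of forward orbits; this is the source of positive
  return times.\<close>

locale minimal_flow =
  fixes X :: "'a::metric_space set" and g :: "int \<Rightarrow> 'a \<Rightarrow> 'a"
  assumes compact_X: "compact X" 
    and g_in: "x \<in> X \<Longrightarrow> g k x \<in> X" and g_out: "x \<notin> X \<Longrightarrow> g k x = x"
    and g_add: "g (j + k) x = g j (g k x)" and g_0: "g 0 x = x"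
    and g_cont: "continuous_on X (g k)"
    and forward_dense: "x \<in> X \<Longrightarrow> y \<in> X \<Longrightarrow> e > 0 \<Longrightarrow> \<exists>k::nat. dist (g (int k) x) y < e"
begin

text \<open>The face group; \<open>Ggen\<close> is the Host-Kra cube group, which adds the diagonal
  exponent \<open>k\<close> and so also moves the origin.\<close>

definition Fgen :: "nat \<Rightarrow> (nat set \<Rightarrow> 'a \<Rightarrow> 'a) set" where
  "Fgen d = {f. \<exists>n. f = (\<lambda>E. g (cube_sum d n E))}"

definition Ggen :: "nat \<Rightarrow> (nat set \<Rightarrow> 'a \<Rightarrow> 'a) set" where
  "Ggen d = {f. \<exists>k n. f = (\<lambda>E. g (k + cube_sum d n E))}"

text \<open>The enveloping semigroups of the group of face transformations and of the full cube group.
  The semigroup \<open>G_env 0\<close> consists of families that do not depend on the vertex, so it is the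
  enveloping semigroup of the flow itself.\<close>

definition F_env :: "nat \<Rightarrow> (nat set \<Rightarrow> 'a \<Rightarrow> 'a) set" where "F_env d = closure (Fgen d)"
definition G_env :: "nat \<Rightarrow> (nat set \<Rightarrow> 'a \<Rightarrow> 'a) set" where "G_env d = closure (Ggen d)"

lemma FgenI: "(\<And>E. f E = g (cube_sum d n E)) \<Longrightarrow> f \<in> Fgen d"
  unfolding Fgen_def by (intro CollectI exI[of _ n]) (rule ext)

lemma GgenI: "(\<And>E. f E = g (k + cube_sum d n E)) \<Longrightarrow> f \<in> Ggen d"
  unfolding Ggen_def by (intro CollectI exI[of _ k] exI[of _ n]) (rule ext)

lemma FgenE: assumes "f \<in> Fgen d" obtains n where "f = (\<lambda>E. g (cube_sum d n E))"
  using assms by (auto simp: Fgen_def)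

lemma GgenE: assumes "f \<in> Ggen d" obtains k n where "f = (\<lambda>E. g (k + cube_sum d n E))"
  using assms by (auto simp: Ggen_def)

lemma Fgen_sub_Ggen: "Fgen d \<subseteq> Ggen d"
proof
  fix f assume "f \<in> Fgen d"
  then obtain n where "f = (\<lambda>E. g (cube_sum d n E))" by (rule FgenE)
  then show "f \<in> Ggen d" by (intro GgenI[of _ 0 d n]) simp
qed

lemma Ggen_selfmaps: "Ggen d \<subseteq> selfmaps X"
proof
  fix f assume "f \<in> Ggen d"
  then obtain k n where "f = (\<lambda>E. g (k + cube_sum d n E))" by (rule GgenE)
  then show "f \<in> selfmaps X" by (auto intro!: selfmapsI simp: g_in g_out)
qed

lemma G_env_selfmaps: "G_env d \<subseteq> selfmaps X"
  unfolding G_env_def by (rule closure_selfmaps[OF compact_X Ggen_selfmaps])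

lemma F_env_sub_G_env: "F_env d \<subseteq> G_env d"
  unfolding F_env_def G_env_def by (rule closure_mono[OF Fgen_sub_Ggen])

lemma Ggen_cont: "f \<in> Ggen d \<Longrightarrow> continuous_on X (f E)"
  by (elim GgenE) (simp add: g_cont)

lemma G_env_semigroup: "compact_semigroup (G_env d) (\<star>)"
  unfolding G_env_def
proof (rule compact_semigroup_closure[OF compact_X Ggen_selfmaps])
  show "continuous_on X (a E)" if "a \<in> Ggen d" for a E using that by (rule Ggen_cont)
  have "(\<lambda>E. g (0 + cube_sum d (\<lambda>_. 0) E)) \<in> Ggen d" by (rule GgenI[of _ 0 d "\<lambda>_. 0"]) simp
  then show "Ggen d \<noteq> {}" by (metis empty_iff)
  show "a \<star> b \<in> Ggen d" if a: "a \<in> Ggen d" and b: "b \<in> Ggen d" for a b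
  proof -
    obtain k n where a: "a = (\<lambda>E. g (k + cube_sum d n E))" using a by (rule GgenE)
    obtain k' n' where b: "b = (\<lambda>E. g (k' + cube_sum d n' E))" using b by (rule GgenE)
    show ?thesis
      by (rule GgenI[of _ "k + k'" d "\<lambda>i. n i + n' i"])
         (simp add: fun_eq_iff a b g_add[symmetric] cube_sum_add[symmetric] algebra_simps)
  qed
qed

lemma F_env_semigroup: "compact_semigroup (F_env d) (\<star>)"
  unfolding F_env_def
proof (rule compact_semigroup_closure[OF compact_X order.trans[OF Fgen_sub_Ggen Ggen_selfmaps]])
  have "(\<lambda>E. g (cube_sum d (\<lambda>_. 0) E)) \<in> Fgen d" by (rule FgenI) simp
  then show "Fgen d \<noteq> {}" by (metis empty_iff)
  show "continuous_on X (a i)" if "a \<in> Fgen d" for a i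
    using that Fgen_sub_Ggen Ggen_cont by blast
  show "a \<star> b \<in> Fgen d" if a: "a \<in> Fgen d" and b: "b \<in> Fgen d" for a b
  proof -
    obtain n where a: "a = (\<lambda>E. g (cube_sum d n E))" using a by (rule FgenE)
    obtain n' where b: "b = (\<lambda>E. g (cube_sum d n' E))" using b by (rule FgenE)
    show ?thesis
      by (rule FgenI[of _ d "\<lambda>i. n i + n' i"])
         (simp add: fun_eq_iff a b g_add[symmetric] cube_sum_add[symmetric])
  qed
qed

lemma F_env_mult: "a \<in> F_env d \<Longrightarrow> b \<in> F_env d \<Longrightarrow> a \<star> b \<in> F_env d"
  and G_env_mult: "a \<in> G_env d \<Longrightarrow> b \<in> G_env d \<Longrightarrow> a \<star> b \<in> G_env d"
  using compact_semigroup.mult_closed F_env_semigroup G_env_semigroup by metis+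

lemma closure_equality:
  fixes A :: "(nat set \<Rightarrow> 'a \<Rightarrow> 'a) set"
  assumes "f \<in> closure A" "\<And>a. a \<in> A \<Longrightarrow> a E x = a E' x" shows "f E x = f E' x"
proof -
  have "closure A \<subseteq> {a. a E x = a E' x}"
    using assms(2) by (intro closure_minimal closed_Collect_eq continuous_on_eval) auto
  then show ?thesis using assms(1) by auto
qed

lemma G_env_Int: assumes "h \<in> G_env d" shows "h (E \<inter> {..<d}) = h E"
proof
  fix x show "h (E \<inter> {..<d}) x = h E x"
    using assms unfolding G_env_def
    by (rule closure_equality) (elim GgenE, simp add: cube_sum_Int)
qed

lemma G_env_0_const: "u \<in> G_env 0 \<Longrightarrow> u E = u {}"
  using G_env_Int[of u 0 E] by simp

lemma F_env_empty: assumes "f \<in> F_env d" "E \<inter> {..<d} = {}" shows "f E = (\<lambda>x. x)"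
proof
  fix x
  have "closure (Fgen d) \<subseteq> {a. a E x = x}"
    by (intro closure_minimal closed_Collect_eq continuous_on_eval continuous_on_const subsetI)
       (auto elim!: FgenE simp: cube_sum_empty[OF assms(2)] g_0)
  then show "f E x = x" using assms(1) unfolding F_env_def by auto
qed

lemma closure_pullback:
  fixes A :: "(nat set \<Rightarrow> 'a \<Rightarrow> 'a) set"
  assumes "f \<in> closure A" and "\<And>a. a \<in> A \<Longrightarrow> (\<lambda>E. a (\<theta> E)) \<in> B"
  shows "(\<lambda>E. f (\<theta> E)) \<in> closure B"
proof -
  have "(\<lambda>f E. f (\<theta> E)) ` closure A \<subseteq> closure B"
    using assms(2) closure_subset
    by (intro image_closure_subset continuous_on_fun2 continuous_on_eval) auto
  then show ?thesis using assms(1) by auto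
qed

text \<open>Reindexing vertices along \<open>\<theta>\<close> is continuous, so it suffices that it
  turns an edge vector \<open>n\<close> into another one, \<open>\<nu> n\<close>. In the version for
  the cube semigroup the origin may move as well, which contributes the diagonal exponent
  \<open>\<kappa> n\<close>.\<close>

lemma F_env_pullback:
  assumes "f \<in> F_env d" and "\<And>n E. cube_sum d n (\<theta> E) = cube_sum d' (\<nu> n) E"
  shows "(\<lambda>E. f (\<theta> E)) \<in> F_env d'"
  using assms(1) unfolding F_env_def
proof (rule closure_pullback)
  fix a assume "a \<in> Fgen d"
  then obtain n where "a = (\<lambda>E. g (cube_sum d n E))" by (rule FgenE)
  then show "(\<lambda>E. a (\<theta> E)) \<in> Fgen d'"
    by (intro FgenI[of _ d' "\<nu> n"]) (simp add: assms(2))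
qed

lemma G_env_pullback:
  assumes "f \<in> G_env d" and "\<And>n E. cube_sum d n (\<theta> E) = \<kappa> n + cube_sum d' (\<nu> n) E"
  shows "(\<lambda>E. f (\<theta> E)) \<in> G_env d'"
  using assms(1) unfolding G_env_def
proof (rule closure_pullback)
  fix a assume "a \<in> Ggen d"
  then obtain k n where "a = (\<lambda>E. g (k + cube_sum d n E))" by (rule GgenE)
  then show "(\<lambda>E. a (\<theta> E)) \<in> Ggen d'"
    by (intro GgenI[of _ "k + \<kappa> n" d' "\<nu> n"]) (simp add: assms(2) add.assoc)
qed

lemma F_env_Suc: "F_env d \<subseteq> F_env (Suc d)"
proof
  fix f assume f: "f \<in> F_env d"
  have "(\<lambda>E. f E) \<in> F_env (Suc d)"
    by (rule F_env_pullback[OF f, where \<nu> = "\<lambda>n i. if i < d then n i else 0"])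
       (simp add: cube_sum_Suc, rule cube_sum_cong, auto)
  then show "f \<in> F_env (Suc d)" by simp
qed

lemma G_env_restrict: assumes "h \<in> G_env (Suc d)" shows "(\<lambda>E. h (E \<inter> {..<d})) \<in> G_env d"
  by (rule G_env_pullback[OF assms, where \<kappa> = "\<lambda>_. 0" and \<nu> = "\<lambda>n. n"])
     (simp add: cube_sum_Suc cube_sum_Int)

lemma G_env_vertex: assumes "h \<in> G_env d" shows "(\<lambda>_. h E) \<in> G_env 0"
  by (rule G_env_pullback[OF assms, where \<kappa> = "\<lambda>n. cube_sum d n E" and \<nu> = "\<lambda>n. n"]) simp

lemma G_env_0_sub: "G_env 0 \<subseteq> G_env d"
proof
  fix f assume f: "f \<in> G_env 0"
  have "(\<lambda>E. f E) \<in> G_env d"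
    by (rule G_env_pullback[OF f, where \<kappa> = "\<lambda>_. 0" and \<nu> = "\<lambda>_ _. 0"]) (simp add: cube_sum_def)
  then show "f \<in> G_env d" by simp
qed

text \<open>On the upper face of the (d+1)-cube the last edge acts as a diagonal exponent, so
  restriction to that face maps the face group onto the cube group of dimension \<open>d\<close>;
  compactness carries this over to the closures.\<close>

lemma G_env_lift:
  assumes "h \<in> G_env d"
  obtains H where "H \<in> F_env (Suc d)" "\<And>E. H (E \<inter> {..<d} \<union> {d}) = h E"
proof -
  define \<Psi> where "\<Psi> H = (\<lambda>E. H (E \<inter> {..<d} \<union> {d}))" for H :: "nat set \<Rightarrow> 'a \<Rightarrow> 'a"
  have "continuous_on (F_env (Suc d)) \<Psi>"
    unfolding \<Psi>_def by (intro continuous_on_fun2 continuous_on_eval)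
  then have "closed (\<Psi> ` F_env (Suc d))"
    using compact_semigroup.compact_E[OF F_env_semigroup] 
    by (intro compact_imp_closed compact_continuous_image)
  moreover have "Ggen d \<subseteq> \<Psi> ` F_env (Suc d)"
  proof
    fix f assume "f \<in> Ggen d"
    then obtain k n where f: "f = (\<lambda>E. g (k + cube_sum d n E))" by (rule GgenE)
    define H where "H = (\<lambda>E. g (cube_sum (Suc d) (n(d := k)) E))"
    have "H \<in> Fgen (Suc d)" unfolding H_def by (rule FgenI) simp
    then have "H \<in> F_env (Suc d)" unfolding F_env_def using closure_subset by (rule subsetD[rotated])
    moreover have "cube_sum (Suc d) (n(d := k)) (E \<inter> {..<d} \<union> {d}) = k + cube_sum d n E" for E
      by (simp add: cube_sum_Suc) (rule cube_sum_cong, auto)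
    then have "f = \<Psi> H" unfolding f \<Psi>_def H_def by simp
    ultimately show "f \<in> \<Psi> ` F_env (Suc d)" by (simp only: image_eqI)
  qed
  ultimately have "G_env d \<subseteq> \<Psi> ` F_env (Suc d)" unfolding G_env_def by (intro closure_minimal)
  then obtain H where "H \<in> F_env (Suc d)" "h = \<Psi> H" using assms by auto
  then show thesis using that[of H] unfolding \<Psi>_def by simp
qed

definition minimal_idempotent :: "(nat set \<Rightarrow> 'a \<Rightarrow> 'a) \<Rightarrow> bool" where
  "minimal_idempotent = compact_semigroup.minimal_idem (G_env 0) (\<star>)"

lemma minimal_idempotentD:
  assumes "minimal_idempotent u" shows "u \<in> G_env 0" "u \<star> u = u" "u E (u E x) = u E x" "u E = u {}"
proof -
  show u: "u \<in> G_env 0" "u \<star> u = u"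
    using assms unfolding minimal_idempotent_def
    by (simp_all add: compact_semigroup.minimal_idemD[OF G_env_semigroup])
  show "u E (u E x) = u E x" using u(2) by (metis fcomp_apply)
  show "u E = u {}" using u(1) by (rule G_env_0_const)
qed

text \<open>\<open>\<Phi> u\<close> applies \<open>u\<close> on the face \<open>d \<in> E\<close>
  and is a limit of face transformations with a single nonzero edge. Multiplying over all directions
  applies \<open>u\<close> once per element of \<open>E \<inter> {..<d}\<close>, which by
  idempotence is \<open>u\<close> at every nonzero vertex.\<close>

lemma truncate_idempotent_in:
  assumes "u \<in> G_env 0" "u \<star> u = u" shows "truncate d u \<in> F_env d"
proof (induction d)
  case 0
  have "truncate 0 u \<in> Fgen 0"
    by (rule FgenI[of _ 0 "\<lambda>_. 0"]) (simp add: truncate_def fun_eq_iff g_0)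
  then show ?case unfolding F_env_def using closure_subset by (rule subsetD[rotated])
next
  case (Suc d)
  define \<Phi> where "\<Phi> f = (\<lambda>E x. if d \<in> E then f E x else x)" for f :: "nat set \<Rightarrow> 'a \<Rightarrow> 'a"
  have "\<Phi> ` closure (Ggen 0) \<subseteq> closure (Fgen (Suc d))"
  proof (rule image_closure_subset)
    show "continuous_on (closure (Ggen 0)) \<Phi>"
    proof (rule continuous_on_fun2)
      fix E x show "continuous_on (closure (Ggen 0)) (\<lambda>f. \<Phi> f E x)"
        by (cases "d \<in> E") (simp_all add: \<Phi>_def continuous_on_eval)
    qed
    show "\<Phi> ` Ggen 0 \<subseteq> closure (Fgen (Suc d))"
    proof
      fix f assume "f \<in> \<Phi> ` Ggen 0"
      then obtain f0 where f0: "f = \<Phi> f0" "f0 \<in> Ggen 0" by auto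
      obtain k n where k: "f0 = (\<lambda>E. g (k + cube_sum 0 n E))" using f0(2) by (rule GgenE)
      have "cube_sum d (\<lambda>i. if i = d then k else 0) E = 0" for E
        unfolding cube_sum_def by (intro sum.neutral) auto
      then have "f \<in> Fgen (Suc d)"
        by (intro FgenI[of _ "Suc d" "\<lambda>i. if i = d then k else 0"])
           (simp add: f0 k \<Phi>_def fun_eq_iff cube_sum_Suc g_0)
      then show "f \<in> closure (Fgen (Suc d))" using closure_subset by (rule subsetD[rotated])
    qed
  qed simp
  then have "\<Phi> u \<in> F_env (Suc d)" using assms(1) unfolding G_env_def F_env_def by (auto simp: image_subset_iff)
  then have "\<Phi> u \<star> truncate d u \<in> F_env (Suc d)"
    using Suc F_env_Suc F_env_mult by (metis subsetD)
  moreover have "u E (u E x) = u E x" for E x using assms(2) by (metis fcomp_apply)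
  then have "\<Phi> u \<star> truncate d u = truncate (Suc d) u"
    by (auto simp: fun_eq_iff \<Phi>_def truncate_def lessThan_Suc)
  ultimately show ?case by simp
qed

text \<open>A minimal idempotent \<open>v\<close> of the left ideal generated by \<open>truncate d u\<close> has all its nontrivial
  coordinates in the minimal left ideal of \<open>u\<close>, where \<open>u\<close> absorbs idempotents.\<close>

lemma truncate_minimal:
  assumes u: "minimal_idempotent u"
  shows "compact_semigroup.minimal_idem (F_env d) (\<star>) (truncate d u)"
proof -
  note uD = minimal_idempotentD[OF u]
  interpret F: compact_semigroup "F_env d" "(\<star>)" by (rule F_env_semigroup)
  interpret G: compact_semigroup "G_env 0" "(\<star>)" by (rule G_env_semigroup)
  let ?w = "truncate d u"
  have w: "?w \<in> F_env d" by (rule truncate_idempotent_in[OF uD(1,2)])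
  have ww: "?w \<star> ?w = ?w" using uD(3) by (simp add: fun_eq_iff truncate_def)
  obtain v p where v: "F.minimal_idem v" "p \<in> F_env d" "v = p \<star> ?w"
    by (rule F.minimal_idem_exists[OF w])
  note vD = F.minimal_idemD[OF v(1)]
  have "?w \<star> v = ?w"
  proof (intro ext)
    fix E x
    show "(?w \<star> v) E x = ?w E x"
    proof (cases "E \<inter> {..<d} = {}")
      case True
      then show ?thesis using F_env_empty[OF vD(1)] by (simp add: truncate_empty)
    next
      case False
      have "u \<star> (\<lambda>_. v E) = u"
      proof (rule G.minimal_idem_absorb[of u "\<lambda>_. p E"])
        show "G.minimal_idem u" using u by (simp add: minimal_idempotent_def)
        show "(\<lambda>_. p E) \<in> G_env 0"
          using v(2) F_env_sub_G_env by (intro G_env_vertex) auto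
        show "(\<lambda>_. v E) = (\<lambda>_. p E) \<star> u"
        proof (intro ext)
          fix E' y
          have "u E' = u E" using uD(4) by metis
          then show "v E y = ((\<lambda>_. p E) \<star> u) E' y"
            using False by (simp add: v(3) truncate_nonempty)
        qed
        have "v E (v E y) = v E y" for y using vD(2) by (metis fcomp_apply)
        then show "(\<lambda>_. v E) \<star> (\<lambda>_. v E) = (\<lambda>_. v E)" by (simp add: fun_eq_iff)
      qed
      then have "u E (v E x) = u E x" by (metis fcomp_apply)
      then show ?thesis using False by (simp add: truncate_nonempty)
    qed
  qed
  note wv = this
  \<comment> \<open>Because \<open>?w \<star> v = ?w\<close>, minimality passes from
    \<open>v\<close> to \<open>?w\<close>: the witness \<open>q\<close> for \<open>v\<close> becomes
    \<open>?w \<star> q\<close>.\<close>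
  have "\<exists>q\<in>F_env d. q \<star> (p \<star> ?w) = ?w" if p: "p \<in> F_env d" for p
  proof -
    obtain q where q: "q \<in> F_env d" "q \<star> (p \<star> ?w \<star> v) = v"
      using v(1) p w unfolding F.minimal_idem_def by (metis F.mult_closed)
    have "p \<star> ?w \<star> v = p \<star> ?w" using wv by (simp add: fcomp_assoc)
    then have "(?w \<star> q) \<star> (p \<star> ?w) = ?w" using q(2) wv by (simp add: fcomp_assoc)
    then show ?thesis using q(1) w by blast
  qed
  then show ?thesis unfolding F.minimal_idem_def using w ww by simp
qed

lemma F_env_group_inverse:
  assumes u: "minimal_idempotent u" and w: "w = truncate d u"
    and f: "f \<in> F_env d" "w \<star> f = f" "f \<star> w = f"
  obtains f' where "f' \<in> F_env d" "w \<star> f' = f'" "f' \<star> w = f'" "f' \<star> f = w" "f \<star> f' = w"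
  using compact_semigroup.minimal_idem_inverse[OF F_env_semigroup truncate_minimal[OF u], of f d thesis] f
  unfolding w by metis

text \<open>Two face elements that agree off the last direction are compared by a quotient
  \<open>\<psi> \<star> \<phi>'\<close>: the first one is \<open>h\<close> on the upper face, the second one repeats there the lower face of \<open>h\<close>.\<close>

lemma G_env_fixing_origin:
  assumes u: "minimal_idempotent u"
  shows "h \<in> G_env d \<Longrightarrow> u \<star> h = h \<Longrightarrow> h \<star> u = h \<Longrightarrow> h {} = u {} \<Longrightarrow> truncate d h \<in> F_env d"
proof (induction d arbitrary: h)
  case 0
  have "truncate 0 h = truncate 0 u" by (simp add: truncate_def)
  then show ?case using truncate_idempotent_in minimal_idempotentD[OF u] by metis
next
  case (Suc d)
  note uD = minimal_idempotentD[OF u]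
  note h = Suc.prems
  have uh: "u E (h E x) = h E x" "h E (u E x) = h E x" for E x
    using h(2,3) by (metis fcomp_apply)+
  obtain H where H: "H \<in> F_env (Suc (Suc d))" "\<And>E. H (E \<inter> {..<Suc d} \<union> {Suc d}) = h E"
    using G_env_lift[OF h(1)] by blast
  \<comment> \<open>Only the upper face of \<open>H\<close> is known. Vertices with
    \<open>d \<in> E\<close> are sent into it, by \<open>\<theta>1\<close> with \<open>d\<close>
    kept and by \<open>\<theta>2\<close> with \<open>d\<close> dropped; on the other vertices both
    maps read the same unknown values of \<open>H\<close>, which cancel in the quotient.\<close>
  define \<theta>1 where "\<theta>1 E = E \<inter> {..<d} \<union> (if d \<in> E then {d, Suc d} else {})" for E
  define \<theta>2 where "\<theta>2 E = E \<inter> {..<d} \<union> (if d \<in> E then {Suc d} else {})" for E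
  define w where "w = truncate (Suc d) u"
  have w: "w \<in> F_env (Suc d)" unfolding w_def by (rule truncate_idempotent_in[OF uD(1,2)])
  have ww: "w \<star> w = w" using uD(3) by (simp add: fun_eq_iff truncate_def w_def)
  have \<theta>: "cube_sum d n (\<theta>1 E) = cube_sum d n E" "cube_sum d n (\<theta>2 E) = cube_sum d n E"
    "cube_sum d (n(d := c)) E = cube_sum d n E" for n E c
    by (intro cube_sum_cong; auto simp: \<theta>1_def \<theta>2_def)+
  have \<theta>_top: "d \<in> \<theta>1 E \<longleftrightarrow> d \<in> E" "Suc d \<in> \<theta>1 E \<longleftrightarrow> d \<in> E" "d \<notin> \<theta>2 E" "Suc d \<in> \<theta>2 E \<longleftrightarrow> d \<in> E" for E
    by (auto simp: \<theta>1_def \<theta>2_def)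
  have 1: "(\<lambda>E. H (\<theta>1 E)) \<in> F_env (Suc d)"
    by (rule F_env_pullback[OF H(1), where \<nu> = "\<lambda>n. n(d := n d + n (Suc d))"])
       (simp add: cube_sum_Suc \<theta> \<theta>_top)
  have 2: "(\<lambda>E. H (\<theta>2 E)) \<in> F_env (Suc d)"
    by (rule F_env_pullback[OF H(1), where \<nu> = "\<lambda>n. n(d := n (Suc d))"])
       (simp add: cube_sum_Suc \<theta> \<theta>_top)
  \<comment> \<open>Multiplying by \<open>w\<close> on both sides moves \<open>\<phi>\<close> into
    the group with neutral element \<open>w\<close>, where it can be inverted; \<open>\<psi>\<close>
    is treated alike to keep the two equal where \<open>d \<notin> E\<close>.\<close>
  define \<psi> where "\<psi> = w \<star> (\<lambda>E. H (\<theta>1 E)) \<star> w"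
  define \<phi> where "\<phi> = w \<star> (\<lambda>E. H (\<theta>2 E)) \<star> w"
  have \<psi>F: "\<psi> \<in> F_env (Suc d)" unfolding \<psi>_def by (intro F_env_mult w 1)
  have \<phi>F: "\<phi> \<in> F_env (Suc d)" unfolding \<phi>_def by (intro F_env_mult w 2)
  have "w \<star> \<phi> = \<phi>" "\<phi> \<star> w = \<phi>"
    unfolding \<phi>_def by (simp_all add: fcomp_assoc ww) (simp add: fcomp_assoc[symmetric] ww)
  then obtain \<phi>' where \<phi>': "\<phi>' \<in> F_env (Suc d)" "w \<star> \<phi>' = \<phi>'" "\<phi>' \<star> w = \<phi>'" "\<phi>' \<star> \<phi> = w" "\<phi> \<star> \<phi>' = w"
    using F_env_group_inverse[OF u w_def \<phi>F] by metis
  have \<phi>'E: "\<phi>' E (w E x) = \<phi>' E x" "\<phi>' E (\<phi> E x) = w E x" "\<phi> E (\<phi>' E x) = w E x" for E x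
    using \<phi>'(3-5) by (metis fcomp_apply)+
  define h1 where "h1 = (\<lambda>E. h (E \<inter> {..<d}))"
  have h1: "truncate d h1 \<in> F_env d"
  proof (rule Suc.IH)
    show "h1 \<in> G_env d" unfolding h1_def by (rule G_env_restrict[OF h(1)])
    show "u \<star> h1 = h1" "h1 \<star> u = h1" "h1 {} = u {}"
      using uh h(4) uD(4) by (simp_all add: fun_eq_iff h1_def) metis+
  qed
  have "\<psi> \<star> \<phi>' \<star> truncate d h1 \<in> F_env (Suc d)"
    using h1 F_env_Suc by (intro F_env_mult \<psi>F \<phi>'(1)) auto
  moreover have "\<psi> \<star> \<phi>' \<star> truncate d h1 = truncate (Suc d) h"
  proof (intro ext)
    fix E x
    have uu: "u E = u E'" for E' using uD(4) by metis
    show "(\<psi> \<star> \<phi>' \<star> truncate d h1) E x = truncate (Suc d) h E x"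
    proof (cases "E \<inter> {..<Suc d} = {}")
      case True
      then have "E \<inter> {..<d} = {}" by auto
      then show ?thesis
        using True F_env_empty[OF \<psi>F True] F_env_empty[OF \<phi>'(1) True] by (simp add: truncate_empty)
    next
      case False
      then have wE: "w E = u E" and tE: "truncate (Suc d) h E = h E"
        by (simp_all add: w_def truncate_nonempty)
      show ?thesis
      proof (cases "d \<in> E")
        case dE: False
        then have Ed: "E \<inter> {..<d} \<noteq> {}" "E \<inter> {..<Suc d} = E \<inter> {..<d}"
          using False by (auto simp: lessThan_Suc)
        have "h1 E = h E" unfolding h1_def using G_env_Int[OF h(1), of E] Ed(2) by simp
        moreover have "\<psi> E = \<phi> E" using dE by (simp add: \<psi>_def \<phi>_def \<theta>1_def \<theta>2_def fun_eq_iff)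
        ultimately show ?thesis using Ed(1) by (simp add: truncate_nonempty tE \<phi>'E wE uh)
      next
        case dE: True
        have "\<theta>1 E = E \<inter> {..<Suc d} \<union> {Suc d}" using dE by (auto simp: \<theta>1_def lessThan_Suc)
        then have "H (\<theta>1 E) = h E" using H(2) by metis
        then have \<psi>E: "\<psi> E y = h E y" for y by (simp add: \<psi>_def wE uh)
        have "\<theta>2 E = (E \<inter> {..<d}) \<inter> {..<Suc d} \<union> {Suc d}" using dE by (auto simp: \<theta>2_def)
        then have "H (\<theta>2 E) = h1 E" using H(2) unfolding h1_def by metis
        then have \<phi>E: "\<phi> E y = h1 E y" for y
          using uh[of "E \<inter> {..<d}"] uu[of "E \<inter> {..<d}"] by (simp add: \<phi>_def wE h1_def)
        show ?thesis
        proof (cases "E \<inter> {..<d} = {}")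
          case True
          \<comment> \<open>Above the origin of the lower face truncation has erased
            \<open>h1\<close>. Nothing is lost, since the hypothesis on \<open>h {}\<close> makes
            \<open>h1\<close> equal to \<open>u\<close> there, so \<open>\<phi>'\<close> is
            \<open>u\<close> too.\<close>
          then have "h1 E = u E" using h(4) uu[of "{}"] by (simp add: h1_def)
          then have "\<phi>' E x = u E x" using \<phi>'E(1,2)[of E x] \<phi>E wE by simp
          then show ?thesis using True by (simp add: truncate_empty tE \<psi>E uh)
        next
          case False
          have "\<phi>' E (h1 E x) = u E x" using \<phi>'E(2)[of E x] \<phi>E wE by simp
          then show ?thesis using False by (simp add: truncate_nonempty tE \<psi>E uh)
        qed
      qed
    qed
  qed
  ultimately show ?case by simp
qed


text \<open>Right multiplication of \<open>u \<star> h \<star> u\<close> by the inverse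
  \<open>r\<close> of its origin coordinate makes that coordinate \<open>u\<close>, as
  \<open>G_env_fixing_origin\<close> requires. The origin coordinate fixes \<open>x\<close>, hence
  so does \<open>r\<close>, and the values at \<open>x\<close> survive.\<close>

lemma cube_through_point:
  assumes u: "minimal_idempotent u" and h: "h \<in> G_env d" and x: "u {} x = x" "h {} x = x"
  obtains f where "f \<in> F_env d" "truncate d u \<star> f = f" "f \<star> truncate d u = f"
    "\<And>E. E \<inter> {..<d} \<noteq> {} \<Longrightarrow> f E x = u E (h E x)"
proof -
  note uD = minimal_idempotentD[OF u]
  interpret G0: compact_semigroup "G_env 0" "(\<star>)" by (rule G_env_semigroup)
  have uG: "u \<in> G_env d" using uD(1) G_env_0_sub by blast
  define h1 where "h1 = u \<star> h \<star> u"
  have h1: "h1 \<in> G_env d" unfolding h1_def by (intro G_env_mult uG h)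
  define a where "a = (\<lambda>_::nat set. h1 {})"
  have aG: "a \<in> G_env 0" unfolding a_def by (rule G_env_vertex[OF h1])
  have ua: "u \<star> a = a" "a \<star> u = a"
    using uD(3,4) by (simp_all add: fun_eq_iff a_def h1_def) metis+
  have "G0.minimal_idem u" using u by (simp add: minimal_idempotent_def)
  then obtain r where r: "r \<in> G_env 0" "u \<star> r = r" "r \<star> u = r" "r \<star> a = u" "a \<star> r = u"
    by (rule G0.minimal_idem_inverse[OF _ aG ua])
  have ux: "u E x = x" for E using x(1) uD(4)[of E] by simp
  have rE: "r E = r {}" for E using r(1) by (rule G_env_0_const)
  have "a {} x = x" by (simp add: a_def h1_def x ux)
  then have rx: "r E x = x" for E using r(4) rE[of E] ux by (metis fcomp_apply)
  define h2 where "h2 = h1 \<star> r"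
  have "truncate d h2 \<in> F_env d"
  proof (rule G_env_fixing_origin[OF u])
    show "h2 \<in> G_env d" unfolding h2_def using r(1) G_env_0_sub by (intro G_env_mult h1) auto
    show "u \<star> h2 = h2" unfolding h2_def h1_def fcomp_assoc[symmetric] uD(2) ..
    show "h2 \<star> u = h2" unfolding h2_def fcomp_assoc r(3) ..
    show "h2 {} = u {}"
    proof
      fix y
      have "h2 {} y = (a \<star> r) {} y" by (simp add: h2_def a_def)
      then show "h2 {} y = u {} y" using r(5) by simp
    qed
  qed
  moreover have "u E (h2 E y) = h2 E y" for E y by (simp add: h2_def h1_def uD(3))
  then have "truncate d u \<star> truncate d h2 = truncate d h2" by (simp add: fun_eq_iff truncate_def)
  moreover have "r E (u E y) = r E y" for E y using r(3) by (metis fcomp_apply)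
  then have "truncate d h2 \<star> truncate d u = truncate d h2" by (simp add: fun_eq_iff truncate_def h2_def)
  moreover have "truncate d h2 E x = u E (h E x)" if "E \<inter> {..<d} \<noteq> {}" for E
    using that by (simp add: truncate_nonempty h2_def h1_def rx ux)
  ultimately show thesis by (rule that)
qed

text \<open>The minimal left ideal \<open>L\<close> of some idempotent below \<open>a\<close> is
  stable under the flow, so its compact image at \<open>y\<close> contains \<open>y\<close> by
  minimality of \<open>X\<close>. The elements of \<open>L\<close> fixing \<open>y\<close> then form
  a closed subsemigroup, and any idempotent in it is minimal.\<close>

lemma minimal_idempotent_fixing:
  assumes a: "a \<in> G_env 0" and y: "y \<in> X"
  obtains v q where "minimal_idempotent v" "q \<in> G_env 0" "v = q \<star> a" "v {} y = y"
proof -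
  interpret G: compact_semigroup "G_env 0" "(\<star>)" by (rule G_env_semigroup)
  obtain u p where u: "G.minimal_idem u" "p \<in> G_env 0" "u = p \<star> a"
    by (rule G.minimal_idem_exists[OF a])
  note uD = G.minimal_idemD[OF u(1)]
  define L where "L = (\<lambda>q. q \<star> u) ` G_env 0"
  have L: "closed L" "L \<subseteq> G_env 0" "compact L"
    unfolding L_def using G.closed_translate[OF G.compact_E subset_refl uD(1)] uD(1) G.compact_E
    by (auto intro!: compact_continuous_image G.right_continuous)
  have Lmult: "p \<star> q \<in> L" if "p \<in> G_env 0" and "q \<in> L" for p q
    using that G.mult_closed uD(1) unfolding L_def by (auto simp: fcomp_assoc[symmetric])
  define S where "S = {q \<in> L. q {} y = y}"
  have "closed ((\<lambda>q. q {} y) ` L)"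
    by (intro compact_imp_closed compact_continuous_image continuous_on_eval L(3))
  moreover have "y \<in> closure ((\<lambda>q. q {} y) ` L)"
  proof (rule closure_approachable[THEN iffD2], intro allI impI)
    fix e :: real assume "e > 0"
    define z where "z = u {} y"
    have zX: "z \<in> X" unfolding z_def using selfmaps_in[OF subsetD[OF G_env_selfmaps uD(1)] y] .
    obtain k :: nat where k: "dist (g (int k) z) y < e" using forward_dense[OF zX y \<open>e > 0\<close>] by blast
    define s where "s = (\<lambda>E::nat set. g (int k))"
    have "s \<in> Ggen 0" unfolding s_def by (rule GgenI[of _ "int k"]) simp
    then have "s \<in> G_env 0" unfolding G_env_def using closure_subset by (rule subsetD[rotated])
    then have "s \<star> u \<in> L" unfolding L_def by (rule imageI)
    then have "(s \<star> u) {} y \<in> (\<lambda>q. q {} y) ` L" by (rule imageI)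
    moreover have "dist ((s \<star> u) {} y) y < e" using k by (simp add: s_def z_def)
    ultimately show "\<exists>z\<in>(\<lambda>q. q {} y) ` L. dist z y < e" by (rule bexI[rotated])
  qed
  ultimately have "y \<in> (\<lambda>q. q {} y) ` L" by (simp add: closure_closed)
  then have "S \<noteq> {}" unfolding S_def by auto
  have "compact_semigroup S (\<star>)"
  proof (rule G.subsemigroup)
    have "S = L \<inter> {q. q {} y = y}" by (auto simp: S_def)
    moreover have "closed {q::nat set \<Rightarrow> 'a \<Rightarrow> 'a. q {} y = y}"
      by (intro closed_Collect_eq continuous_on_eval continuous_on_const)
    ultimately show "closed S" using L(1) by auto
    show "p \<star> q \<in> S" if "p \<in> S" "q \<in> S" for p q
      using that Lmult[of p q] L(2) by (auto simp: S_def)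
  qed (use \<open>S \<noteq> {}\<close> L in \<open>auto simp: S_def\<close>)
  then obtain v where v: "v \<in> S" "v \<star> v = v" by (rule compact_semigroup.idempotent_exists)
  then obtain q where q: "q \<in> G_env 0" "v = q \<star> u" by (auto simp: S_def L_def)
  have vG: "v \<in> G_env 0" using q uD(1) G.mult_closed by simp
  have "\<exists>q'\<in>G_env 0. q' \<star> (p \<star> v) = v" if p: "p \<in> G_env 0" for p
  proof -
    have "p \<star> q \<in> G_env 0" using p q(1) by (rule G.mult_closed)
    then obtain q' where q': "q' \<in> G_env 0" "q' \<star> (p \<star> q \<star> u) = u"
      using u(1) unfolding G.minimal_idem_def by blast
    then have "(q \<star> q') \<star> (p \<star> v) = v" unfolding q(2) by (simp add: fcomp_assoc)
    moreover have "q \<star> q' \<in> G_env 0" using q(1) q'(1) by (rule G.mult_closed)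
    ultimately show ?thesis by (rule rev_bexI[rotated])
  qed
  then have "minimal_idempotent v"
    unfolding minimal_idempotent_def G.minimal_idem_def using v(2) vG by simp
  moreover have "q \<star> p \<in> G_env 0" using q(1) u(2) by (rule G.mult_closed)
  moreover have "v = q \<star> p \<star> a" unfolding q(2) u(3) by (rule fcomp_assoc[symmetric])
  moreover have "v {} y = y" using v(1) by (simp add: S_def)
  ultimately show thesis by (rule that)
qed

section \<open>Regional proximality expressed by the face semigroup\<close>

lemma finite_equicontinuous:
  assumes "finite J" "z \<in> X" "e > 0"
  obtains \<eta> where "\<eta> > 0" "\<And>z' m. z' \<in> X \<Longrightarrow> dist z' z < \<eta> \<Longrightarrow> m \<in> J \<Longrightarrow> dist (g m z') (g m z) < e"
proof -
  have "\<exists>\<eta>>0. \<forall>z'\<in>X. dist z' z < \<eta> \<longrightarrow> (\<forall>m\<in>J. dist (g m z') (g m z) < e)"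
    using assms(1)
  proof (induction J)
    case empty
    then show ?case by (intro exI[of _ 1]) simp
  next
    case (insert m J)
    then obtain \<eta> where \<eta>: "\<eta> > 0" "\<forall>z'\<in>X. dist z' z < \<eta> \<longrightarrow> (\<forall>m\<in>J. dist (g m z') (g m z) < e)" by blast
    obtain \<eta>' where \<eta>': "\<eta>' > 0" "\<forall>z'\<in>X. dist z' z < \<eta>' \<longrightarrow> dist (g m z') (g m z) < e"
      using g_cont[of m] assms(2,3) unfolding continuous_on_iff by blast
    show ?case using \<eta> \<eta>' by (intro exI[of _ "min \<eta> \<eta>'"]) auto
  qed
  then show thesis using that by blast
qed

definition reg_prox :: "nat \<Rightarrow> 'a \<Rightarrow> 'a \<Rightarrow> bool" where
  "reg_prox d x y \<longleftrightarrow> x \<in> X \<and> y \<in> X \<and> (\<forall>\<delta>>0. \<exists>x'\<in>X. \<exists>y'\<in>X. \<exists>n::nat \<Rightarrow> int.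
      dist x x' < \<delta> \<and> dist y y' < \<delta> \<and>
      (\<forall>E. E \<subseteq> {..<d} \<and> E \<noteq> {} \<longrightarrow> dist (g (\<Sum>i\<in>E. n i) x') (g (\<Sum>i\<in>E. n i) y') < \<delta>))"

definition face_reach :: "nat \<Rightarrow> 'a \<Rightarrow> 'a \<Rightarrow> bool" where
  "face_reach d x y \<longleftrightarrow> (\<exists>f\<in>F_env d. \<forall>E. E \<inter> {..<d} \<noteq> {} \<longrightarrow> f E x = y)"

text \<open>\<open>x'\<close> and \<open>y'\<close> are replaced by points \<open>g k x\<close> and
  \<open>g j x\<close> of the orbit of \<open>x\<close>, close enough to shadow the two finite
  cubes. This gives an approximate (d+1)-cube with lower face at \<open>x'\<close> and upper face at
  \<open>y'\<close>; compactness of the cube semigroup makes the relations exact.\<close>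

lemma reg_prox_cube:
  assumes "reg_prox d x y"
  obtains h where "h \<in> G_env (Suc d)" "h {} x = x" "h {d} x = y"
    "\<And>E. E \<subseteq> {..<d} \<Longrightarrow> E \<noteq> {} \<Longrightarrow> h (insert d E) x = h E x"
proof -
  have X: "x \<in> X" "y \<in> X" using assms by (auto simp: reg_prox_def)
  define C where "C m = {h. dist (h {} x) x \<le> 1 / real (Suc m)} \<inter> {h. dist (h {d} x) y \<le> 1 / real (Suc m)} \<inter>
     (\<Inter>E\<in>Pow {..<d} - {{}}. {h. dist (h (insert d E) x) (h E x) \<le> 1 / real (Suc m)})" for m
  have cl: "closed (C m)" for m
    unfolding C_def
    by (intro closed_Int closed_INT ballI closed_Collect_le continuous_on_const continuous_on_dist continuous_on_eval)
  have mono: "C m \<subseteq> C n" if "n \<le> m" for m n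
  proof -
    have "1 / real (Suc m) \<le> 1 / real (Suc n)" using that by (simp add: field_simps)
    then show ?thesis unfolding C_def by (intro Int_mono INF_mono) (auto intro: order.trans)
  qed
  have ne: "G_env (Suc d) \<inter> C m \<noteq> {}" for m
  proof -
    define \<delta> where "\<delta> = 1 / real (Suc m)"
    have \<delta>: "\<delta> / 3 > 0" by (simp add: \<delta>_def)
    then obtain x' y' n where xy: "x' \<in> X" "y' \<in> X" "dist x x' < \<delta> / 3" "dist y y' < \<delta> / 3"
      and n: "\<And>E. E \<subseteq> {..<d} \<Longrightarrow> E \<noteq> {} \<Longrightarrow> dist (g (\<Sum>i\<in>E. n i) x') (g (\<Sum>i\<in>E. n i) y') < \<delta> / 3"
      using assms unfolding reg_prox_def by meson
    define J where "J = (\<lambda>E. \<Sum>i\<in>E. n i) ` Pow {..<d}"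
    have J: "finite J" by (simp add: J_def)
    obtain \<eta> where \<eta>: "\<eta> > 0" "\<And>z' m. z' \<in> X \<Longrightarrow> dist z' x' < \<eta> \<Longrightarrow> m \<in> J \<Longrightarrow> dist (g m z') (g m x') < \<delta> / 3"
      using finite_equicontinuous[OF J xy(1) \<delta>] by blast
    obtain \<eta>' where \<eta>': "\<eta>' > 0" "\<And>z' m. z' \<in> X \<Longrightarrow> dist z' y' < \<eta>' \<Longrightarrow> m \<in> J \<Longrightarrow> dist (g m z') (g m y') < \<delta> / 3"
      using finite_equicontinuous[OF J xy(2) \<delta>] by blast
    obtain k :: nat where k: "dist (g (int k) x) x' < \<eta>" using forward_dense[OF X(1) xy(1) \<eta>(1)] by blast
    obtain j :: nat where j: "dist (g (int j) x) y' < \<eta>'" using forward_dense[OF X(1) xy(2) \<eta>'(1)] by blast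
    \<comment> \<open>The new edge leads from the visit of \<open>x'\<close> to the visit of
      \<open>y'\<close>.\<close>
    define n' where "n' = n(d := int j - int k)"
    define h where "h = (\<lambda>E. g (int k + cube_sum (Suc d) n' E))"
    have "h \<in> Ggen (Suc d)" unfolding h_def by (rule GgenI) simp
    then have hG: "h \<in> G_env (Suc d)" unfolding G_env_def using closure_subset by (rule subsetD[rotated])
    have cs: "cube_sum (Suc d) n' E = (\<Sum>i\<in>E. n i)"
      "cube_sum (Suc d) n' (insert d E) = (\<Sum>i\<in>E. n i) + (int j - int k)" if E: "E \<subseteq> {..<d}" for E
    proof -
      have "cube_sum d n' E' = (\<Sum>i\<in>E. n i)" if "E' \<inter> {..<d} = E" for E'
      proof -
        have "cube_sum d n' E' = cube_sum d n E"
          using that by (intro cube_sum_cong) (auto simp: n'_def)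
        then show ?thesis using E by (simp add: cube_sum_eq)
      qed
      moreover have "E \<inter> {..<d} = E" "insert d E \<inter> {..<d} = E" "d \<notin> E" using E by auto
      ultimately show "cube_sum (Suc d) n' E = (\<Sum>i\<in>E. n i)"
        "cube_sum (Suc d) n' (insert d E) = (\<Sum>i\<in>E. n i) + (int j - int k)"
        by (simp_all add: cube_sum_Suc n'_def)
    qed
    have hE: "h E x = g (\<Sum>i\<in>E. n i) (g (int k) x)" "h (insert d E) x = g (\<Sum>i\<in>E. n i) (g (int j) x)"
      if "E \<subseteq> {..<d}" for E
      using cs[OF that] by (simp_all add: h_def g_add[symmetric] algebra_simps)
    have near: "dist (h E x) (g (\<Sum>i\<in>E. n i) x') < \<delta> / 3" "dist (h (insert d E) x) (g (\<Sum>i\<in>E. n i) y') < \<delta> / 3"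
      if "E \<subseteq> {..<d}" for E
    proof -
      have "(\<Sum>i\<in>E. n i) \<in> J" using that by (simp add: J_def)
      then show "dist (h E x) (g (\<Sum>i\<in>E. n i) x') < \<delta> / 3" "dist (h (insert d E) x) (g (\<Sum>i\<in>E. n i) y') < \<delta> / 3"
        unfolding hE[OF that] using \<eta>(2)[OF g_in[OF X(1)] k] \<eta>'(2)[OF g_in[OF X(1)] j] by blast+
    qed
    have "dist (h {} x) x \<le> \<delta>" "dist (h {d} x) y \<le> \<delta>"
      using near[of "{}"] xy(3,4) dist_triangle2[of "h {} x" x x'] dist_triangle2[of "h {d} x" y y'] \<delta>
      by (simp_all add: g_0)
    moreover have "dist (h (insert d E) x) (h E x) \<le> \<delta>" if "E \<subseteq> {..<d}" "E \<noteq> {}" for E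
      using near[OF that(1)] n[OF that]
        dist_triangle[of "h (insert d E) x" "h E x" "g (\<Sum>i\<in>E. n i) y'"]
        dist_triangle[of "g (\<Sum>i\<in>E. n i) y'" "h E x" "g (\<Sum>i\<in>E. n i) x'"]
      by (simp add: dist_commute)
    ultimately have "h \<in> C m" unfolding C_def \<delta>_def[symmetric] by simp
    then show ?thesis using hG by blast
  qed
  have "G_env (Suc d) \<inter> (\<Inter>m. C m) \<noteq> {}"
  proof (rule compact_imp_fip_image[OF compact_semigroup.compact_E[OF G_env_semigroup] cl])
    show "G_env (Suc d) \<inter> (\<Inter>n\<in>N. C n) \<noteq> {}" if "finite N" for N
    proof -
      obtain m where m: "\<forall>n\<in>N. n \<le> m" using \<open>finite N\<close> finite_nat_set_iff_bounded_le by blast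
      then have "C m \<subseteq> (\<Inter>n\<in>N. C n)" by (intro INF_greatest mono) auto
      then show ?thesis using ne[of m] by blast
    qed
  qed
  then obtain h where h: "h \<in> G_env (Suc d)" "\<And>m. h \<in> C m" by auto
  have eq: "a = b" if "\<And>m. dist a b \<le> 1 / real (Suc m)" for a b :: 'a
  proof (rule ccontr)
    assume "a \<noteq> b"
    then obtain m where "1 / real (Suc m) < dist a b"
      using reals_Archimedean[of "dist a b"] by (auto simp: inverse_eq_divide)
    then show False using that[of m] by simp
  qed
  show thesis
  proof (rule that[OF h(1)])
    show "h {} x = x" using h(2) unfolding C_def by (intro eq) auto
    show "h {d} x = y" using h(2) unfolding C_def by (intro eq) auto
    show "h (insert d E) x = h E x" if "E \<subseteq> {..<d}" "E \<noteq> {}" for E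
    proof (rule eq)
      fix m
      have "E \<in> Pow {..<d} - {{}}" using that by simp
      then show "dist (h (insert d E) x) (h E x) \<le> 1 / real (Suc m)"
        using h(2)[of m] unfolding C_def by blast
    qed
  qed
qed

text \<open>The step to dimension d+1 uses order \<open>d\<close> only. The cube \<open>h\<close>
  has faces that agree off their origins \<open>x\<close> and \<open>y\<close>, so a
  \<open>d\<close>-dimensional face element acting on both faces at once can turn all values except
  that at the origin into \<open>y\<close>.\<close>

theorem reg_prox_face_reach:
  assumes rp: "\<And>d. reg_prox d x y"
  shows "face_reach d x y"
proof (induction d)
  case 0
  have "(\<lambda>E. g (cube_sum 0 (\<lambda>_. 0) E)) \<in> Fgen 0" by (rule FgenI) simp
  then have "F_env 0 \<noteq> {}" unfolding F_env_def using closure_subset by blast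
  then show ?case unfolding face_reach_def by auto
next
  case (Suc d)
  have X: "x \<in> X" "y \<in> X" using rp[of 0] by (auto simp: reg_prox_def)
  obtain f0 where f0: "f0 \<in> F_env d" "\<And>E. E \<inter> {..<d} \<noteq> {} \<Longrightarrow> f0 E x = y"
    using Suc unfolding face_reach_def by blast
  obtain h where h: "h \<in> G_env (Suc d)" "h {} x = x" "h {d} x = y"
    "\<And>E. E \<subseteq> {..<d} \<Longrightarrow> E \<noteq> {} \<Longrightarrow> h (insert d E) x = h E x"
    by (rule reg_prox_cube[OF rp[of d]]) blast
  have "G_env 0 \<noteq> {}" by (rule compact_semigroup.nonempty_E[OF G_env_semigroup])
  then obtain a where "a \<in> G_env 0" by blast
  then obtain u where u: "minimal_idempotent u" "u {} x = x"
    using minimal_idempotent_fixing[OF _ X(1)] by metis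
  note uD = minimal_idempotentD[OF u(1)]
  have ux: "u E x = x" for E using u(2) uD(4)[of E] by simp
  let ?w = "truncate d u"
  obtain f1 where f1: "f1 \<in> F_env d" "?w \<star> f1 = f1" "f1 \<star> ?w = f1"
    "\<And>E. E \<inter> {..<d} \<noteq> {} \<Longrightarrow> f1 E x = u E (h (E \<inter> {..<d}) x)"
    by (rule cube_through_point[OF u(1) G_env_restrict[OF h(1)] u(2)]) (use h(2) in auto)
  obtain f2 where f2: "f2 \<in> F_env d" "f2 \<star> f1 = ?w"
    using F_env_group_inverse[OF u(1) refl f1(1-3)] by metis
  \<comment> \<open>At nonzero vertices of the lower face, \<open>f2\<close> undoes the cube and
    brings its values back to \<open>x\<close>; then \<open>f0\<close>, from the induction
    hypothesis, sends \<open>x\<close> to \<open>y\<close>.\<close>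
  define k where "k = f0 \<star> f2 \<star> ?w"
  have kF: "k \<in> F_env d" unfolding k_def
    by (intro F_env_mult f0(1) f2(1) truncate_idempotent_in uD(1,2))
  have kE: "k E (h (E \<inter> {..<d}) x) = y" if "E \<inter> {..<d} \<noteq> {}" for E
  proof -
    have "f2 E (f1 E x) = x" using f2(2) ux that by (metis fcomp_apply truncate_nonempty)
    then show ?thesis using f0(2) f1(4) that by (simp add: k_def truncate_nonempty)
  qed
  \<comment> \<open>\<open>k\<close> ignores direction \<open>d\<close> and is trivial at the
    vertices \<open>{}\<close> and \<open>{d}\<close>, where \<open>h\<close> already has the right
    values \<open>x\<close> and \<open>y\<close>.\<close>
  define h2 where "h2 = k \<star> h"
  have "k \<in> G_env (Suc d)" using kF F_env_Suc F_env_sub_G_env by blast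
  then have h2G: "h2 \<in> G_env (Suc d)" unfolding h2_def by (intro G_env_mult h(1))
  have "k {} = (\<lambda>x. x)" by (rule F_env_empty[OF kF]) simp
  then have h20: "h2 {} x = x" by (simp add: h2_def h(2))
  have h2y: "h2 E x = y" if "E \<inter> {..<Suc d} \<noteq> {}" for E
  proof -
    have hE: "h E x = h (E \<inter> {..<Suc d}) x" using G_env_Int[OF h(1), of E] by simp
    show ?thesis
    proof (cases "E \<inter> {..<d} = {}")
      case True
      then have "E \<inter> {..<Suc d} = {d}" using that by (auto simp: lessThan_Suc)
      then show ?thesis using hE F_env_empty[OF kF True] by (simp add: h2_def h(3))
    next
      case False
      have "E \<inter> {..<Suc d} = (if d \<in> E then insert d (E \<inter> {..<d}) else E \<inter> {..<d})"
        by (auto simp: lessThan_Suc)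
      then have "h E x = h (E \<inter> {..<d}) x" using hE h(4)[of "E \<inter> {..<d}"] False by auto
      then show ?thesis using kE[OF False] by (simp add: h2_def)
    qed
  qed
  obtain f where f: "f \<in> F_env (Suc d)" "\<And>E. E \<inter> {..<Suc d} \<noteq> {} \<Longrightarrow> f E x = u E (h2 E x)"
    by (rule cube_through_point[OF u(1) h2G u(2) h20]) blast
  \<comment> \<open>\<open>f\<close> reaches only \<open>u E y\<close>, which may differ from
    \<open>y\<close>. As \<open>v\<close> lies in the left ideal of \<open>u\<close>, it satisfies
    \<open>v \<star> u = v\<close>, so it sends this point to \<open>v E y = y\<close>.\<close>
  obtain v q where v: "minimal_idempotent v" "q \<in> G_env 0" "v = q \<star> u" "v {} y = y"
    by (rule minimal_idempotent_fixing[OF uD(1) X(2)])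
  note vD = minimal_idempotentD[OF v(1)]
  have "v E (u E z) = v E z" for E z using uD(3) unfolding v(3) by simp
  moreover have "v E y = y" for E using v(4) vD(4)[of E] by simp
  ultimately have "(truncate (Suc d) v \<star> f) E x = y" if "E \<inter> {..<Suc d} \<noteq> {}" for E
    using that by (simp add: truncate_nonempty f(2) h2y)
  moreover have "truncate (Suc d) v \<star> f \<in> F_env (Suc d)"
    by (intro F_env_mult truncate_idempotent_in vD(1,2) f(1))
  ultimately show ?case unfolding face_reach_def by blast
qed

lemma face_reach_trans:
  assumes "face_reach d x y" "face_reach d y z" shows "face_reach d x z"
proof -
  obtain f where f: "f \<in> F_env d" "\<And>E. E \<inter> {..<d} \<noteq> {} \<Longrightarrow> f E x = y"
    using assms(1) unfolding face_reach_def by blast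
  obtain f' where f': "f' \<in> F_env d" "\<And>E. E \<inter> {..<d} \<noteq> {} \<Longrightarrow> f' E y = z"
    using assms(2) unfolding face_reach_def by blast
  have "f' \<star> f \<in> F_env d" by (rule F_env_mult[OF f'(1) f(1)])
  then show ?thesis unfolding face_reach_def using f(2) f'(2) by (intro bexI[of _ "f' \<star> f"]) auto
qed

lemma face_reach_approx:
  assumes "face_reach d x y" "e > 0"
  obtains n where "\<And>E. E \<subseteq> {..<d} \<Longrightarrow> E \<noteq> {} \<Longrightarrow> dist (g (\<Sum>i\<in>E. n i) x) y < e"
proof -
  obtain f where f: "f \<in> F_env d" "\<And>E. E \<inter> {..<d} \<noteq> {} \<Longrightarrow> f E x = y"
    using assms(1) unfolding face_reach_def by blast
  define W where "W = (\<Inter>E\<in>Pow {..<d} - {{}}. {h::nat set \<Rightarrow> 'a \<Rightarrow> 'a. h E x \<in> ball y e})"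
  have "open W" unfolding W_def by (intro open_INT ballI open_eval_vimage open_ball) simp
  moreover have "f \<in> W" unfolding W_def using f(2) assms(2) by (auto simp: Int_absorb2)
  ultimately obtain a where a: "a \<in> Fgen d" "a \<in> W"
    using f(1) unfolding F_env_def by (elim closure_approx)
  obtain n where "a = (\<lambda>E. g (cube_sum d n E))" using a(1) by (rule FgenE)
  then show thesis using a(2) by (intro that[of n]) (auto simp: W_def cube_sum_eq dist_commute)
qed

text \<open>The last edge is spent on the second point, \<open>y' = g (n d) x'\<close>: then a
  vertex of the \<open>d\<close>-cube applied to \<open>x'\<close> or to \<open>y'\<close> is a
  nonzero vertex of the (d+1)-cube at \<open>x'\<close>, so both images are near
  \<open>y\<close>.\<close>

lemma reg_proxI:
  assumes X: "x \<in> X" "y \<in> X"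
    and n: "\<And>\<delta>. \<delta> > 0 \<Longrightarrow> \<exists>x'\<in>X. dist x x' < \<delta> \<and>
      (\<exists>n. \<forall>E. E \<subseteq> {..<Suc d} \<and> E \<noteq> {} \<longrightarrow> dist (g (\<Sum>i\<in>E. n i) x') y < \<delta>)"
  shows "reg_prox d x y"
  unfolding reg_prox_def
proof (intro conjI X allI impI)
  fix \<delta> :: real assume "\<delta> > 0"
  then have "\<delta> / 2 > 0" by simp
  from n[OF this] obtain x' n where x': "x' \<in> X" "dist x x' < \<delta> / 2"
    and n: "\<And>E. E \<subseteq> {..<Suc d} \<Longrightarrow> E \<noteq> {} \<Longrightarrow> dist (g (\<Sum>i\<in>E. n i) x') y < \<delta> / 2" by blast
  have "dist (g (\<Sum>i\<in>E. n i) x') (g (\<Sum>i\<in>E. n i) (g (n d) x')) < \<delta>" if E: "E \<subseteq> {..<d}" "E \<noteq> {}" for E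
  proof -
    have "d \<notin> E" "finite E" "E \<subseteq> {..<Suc d}" using E by (auto intro: finite_subset)
    then have "dist (g (\<Sum>i\<in>E. n i) (g (n d) x')) y < \<delta> / 2"
      using n[of "insert d E"] by (simp add: g_add[symmetric] add.commute)
    with n[OF \<open>E \<subseteq> {..<Suc d}\<close> E(2)] show ?thesis by (rule dist_triangle_half_l)
  qed
  moreover have "dist y (g (n d) x') < \<delta>" using n[of "{d}"] \<open>\<delta> > 0\<close> by (simp add: dist_commute)
  ultimately show "\<exists>x'\<in>X. \<exists>y'\<in>X. \<exists>n. dist x x' < \<delta> \<and> dist y y' < \<delta> \<and>
      (\<forall>E. E \<subseteq> {..<d} \<and> E \<noteq> {} \<longrightarrow> dist (g (\<Sum>i\<in>E. n i) x') (g (\<Sum>i\<in>E. n i) y') < \<delta>)"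
    using x' \<open>\<delta> > 0\<close> g_in[OF x'(1), of "n d"]
    by (intro bexI[of _ x'] bexI[of _ "g (n d) x'"] exI[of _ n]) auto
qed

lemma face_reach_reg_prox:
  assumes "x \<in> X" "y \<in> X" "face_reach (Suc d) x y" shows "reg_prox d x y"
proof (rule reg_proxI[OF assms(1,2)])
  fix \<delta> :: real assume "\<delta> > 0"
  then obtain n where "\<And>E. E \<subseteq> {..<Suc d} \<Longrightarrow> E \<noteq> {} \<Longrightarrow> dist (g (\<Sum>i\<in>E. n i) x) y < \<delta>"
    using face_reach_approx[OF assms(3)] by blast
  then show "\<exists>x'\<in>X. dist x x' < \<delta> \<and>
      (\<exists>n. \<forall>E. E \<subseteq> {..<Suc d} \<and> E \<noteq> {} \<longrightarrow> dist (g (\<Sum>i\<in>E. n i) x') y < \<delta>)"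
    using assms(1) \<open>\<delta> > 0\<close> by (intro bexI[of _ x] conjI exI[of _ n]) auto
qed

lemma reg_prox_sym: assumes "reg_prox d x y" shows "reg_prox d y x"
  unfolding reg_prox_def
proof (intro conjI allI impI)
  fix \<delta> :: real assume "\<delta> > 0"
  then obtain x' y' n where xy: "x' \<in> X" "y' \<in> X" "dist x x' < \<delta>" "dist y y' < \<delta>"
    and n: "\<And>E. E \<subseteq> {..<d} \<and> E \<noteq> {} \<Longrightarrow> dist (g (\<Sum>i\<in>E. n i) x') (g (\<Sum>i\<in>E. n i) y') < \<delta>"
    using assms unfolding reg_prox_def by meson
  have "dist (g (\<Sum>i\<in>E. n i) y') (g (\<Sum>i\<in>E. n i) x') < \<delta>" if "E \<subseteq> {..<d} \<and> E \<noteq> {}" for E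
    using n[OF that] by (simp only: dist_commute)
  with xy show "\<exists>x'\<in>X. \<exists>y'\<in>X. \<exists>n. dist y x' < \<delta> \<and> dist x y' < \<delta> \<and>
      (\<forall>E. E \<subseteq> {..<d} \<and> E \<noteq> {} \<longrightarrow> dist (g (\<Sum>i\<in>E. n i) x') (g (\<Sum>i\<in>E. n i) y') < \<delta>)"
    by (intro bexI[of _ y'] bexI[of _ x'] exI[of _ n]) simp_all
qed (use assms in \<open>simp_all add: reg_prox_def\<close>)

lemma reg_prox_invariant: assumes "reg_prox d x y" shows "reg_prox d (g k x) (g k y)"
  unfolding reg_prox_def
proof (intro conjI allI impI)
  show "g k x \<in> X" "g k y \<in> X" using assms by (simp_all add: reg_prox_def g_in)
  fix \<delta> :: real assume "\<delta> > 0"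
  then obtain \<eta> where \<eta>: "\<eta> > 0" "\<And>a b. a \<in> X \<Longrightarrow> b \<in> X \<Longrightarrow> dist a b < \<eta> \<Longrightarrow> dist (g k a) (g k b) < \<delta>"
    using compact_uniformly_continuous[OF g_cont[of k] compact_X] unfolding uniformly_continuous_on_def by metis
  obtain x' y' n where xy: "x' \<in> X" "y' \<in> X" "dist x x' < \<eta>" "dist y y' < \<eta>"
    and n: "\<And>E. E \<subseteq> {..<d} \<and> E \<noteq> {} \<Longrightarrow> dist (g (\<Sum>i\<in>E. n i) x') (g (\<Sum>i\<in>E. n i) y') < \<eta>"
    using assms \<eta>(1) unfolding reg_prox_def by meson
  have X: "x \<in> X" "y \<in> X" using assms by (simp_all add: reg_prox_def)
  have comm: "g s (g k z) = g k (g s z)" for s z by (simp add: g_add[symmetric] add.commute)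
  have "dist (g (\<Sum>i\<in>E. n i) (g k x')) (g (\<Sum>i\<in>E. n i) (g k y')) < \<delta>" if "E \<subseteq> {..<d} \<and> E \<noteq> {}" for E
    unfolding comm by (intro \<eta>(2) g_in xy n that)
  moreover have "dist (g k x) (g k x') < \<delta>" "dist (g k y) (g k y') < \<delta>"
    using \<eta>(2) X xy by simp_all
  ultimately show "\<exists>x'\<in>X. \<exists>y'\<in>X. \<exists>n. dist (g k x) x' < \<delta> \<and> dist (g k y) y' < \<delta> \<and>
      (\<forall>E. E \<subseteq> {..<d} \<and> E \<noteq> {} \<longrightarrow> dist (g (\<Sum>i\<in>E. n i) x') (g (\<Sum>i\<in>E. n i) y') < \<delta>)"
    using xy g_in by (intro bexI[of _ "g k x'"] bexI[of _ "g k y'"] exI[of _ n]) simp_all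
qed

lemma closed_reg_prox: "closed {p. reg_prox d (fst p) (snd p)}"
proof (rule closed_sequential_limits[THEN iffD2], intro allI impI, elim conjE)
  fix q p assume q: "\<forall>n. q n \<in> {p. reg_prox d (fst p) (snd p)}" and lim: "q \<longlonglongrightarrow> p"
  have clX: "closed X" using compact_X by (rule compact_imp_closed)
  have qX: "fst (q n) \<in> X" "snd (q n) \<in> X" for n using q by (simp_all add: reg_prox_def)
  have X: "fst p \<in> X" "snd p \<in> X"
    using closed_sequentially[OF clX qX(1) tendsto_fst[OF lim]] closed_sequentially[OF clX qX(2) tendsto_snd[OF lim]]
    by simp_all
  have "\<exists>x'\<in>X. \<exists>y'\<in>X. \<exists>n. dist (fst p) x' < \<delta> \<and> dist (snd p) y' < \<delta> \<and>
      (\<forall>E. E \<subseteq> {..<d} \<and> E \<noteq> {} \<longrightarrow> dist (g (\<Sum>i\<in>E. n i) x') (g (\<Sum>i\<in>E. n i) y') < \<delta>)"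
    if "\<delta> > 0" for \<delta>
  proof -
    have d2: "\<delta> / 2 > 0" using that by simp
    then obtain m where m: "dist (q m) p < \<delta> / 2"
      using lim unfolding lim_sequentially by blast
    have rp: "reg_prox d (fst (q m)) (snd (q m))" using q by simp
    obtain x' y' n where xy: "x' \<in> X" "y' \<in> X" "dist (fst (q m)) x' < \<delta> / 2" "dist (snd (q m)) y' < \<delta> / 2"
      and n: "\<And>E. E \<subseteq> {..<d} \<and> E \<noteq> {} \<Longrightarrow> dist (g (\<Sum>i\<in>E. n i) x') (g (\<Sum>i\<in>E. n i) y') < \<delta> / 2"
      using rp d2 unfolding reg_prox_def by meson
    have "dist (fst p) x' < \<delta>"
      using xy(3) m dist_fst_le[of "q m" p] dist_triangle3[of "fst p" x' "fst (q m)"] by simp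
    moreover have "dist (snd p) y' < \<delta>"
      using xy(4) m dist_snd_le[of "q m" p] dist_triangle3[of "snd p" y' "snd (q m)"] by simp
    moreover have "dist (g (\<Sum>i\<in>E. n i) x') (g (\<Sum>i\<in>E. n i) y') < \<delta>" if "E \<subseteq> {..<d} \<and> E \<noteq> {}" for E
      using n[OF that] \<open>\<delta> > 0\<close> by simp
    ultimately show ?thesis using xy(1,2) by (intro bexI[of _ x'] bexI[of _ y'] exI[of _ n]) simp_all
  qed
  then show "p \<in> {p. reg_prox d (fst p) (snd p)}" using X by (simp add: reg_prox_def)
qed

lemma reg_prox_inf_trans:
  assumes "\<And>d. reg_prox d x y" "\<And>d. reg_prox d y z" shows "reg_prox d x z"
proof (rule face_reach_reg_prox)
  show "x \<in> X" "z \<in> X" using assms[of 0] by (auto simp: reg_prox_def)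
  show "face_reach (Suc d) x z"
    using reg_prox_face_reach[OF assms(1)] reg_prox_face_reach[OF assms(2)] by (rule face_reach_trans)
qed

text \<open>IP-recurrence built one generator at a time: the next return brings \<open>x\<close> so
  close to itself that all earlier sums still return.\<close>

lemma late_returns:
  assumes x: "x \<in> X" and "\<eta> > 0"
  shows "\<exists>m::nat \<Rightarrow> nat. (\<forall>i<l. N \<le> m i) \<and> (\<forall>E\<subseteq>{..<l}. dist (g (\<Sum>i\<in>E. int (m i)) x) x < \<eta>)"
proof (induction l)
  case 0
  then show ?case using \<open>\<eta> > 0\<close> by (simp add: g_0)
next
  case (Suc l)
  then obtain m :: "nat \<Rightarrow> nat" where m: "\<And>i. i < l \<Longrightarrow> N \<le> m i"
    "\<And>E. E \<subseteq> {..<l} \<Longrightarrow> dist (g (\<Sum>i\<in>E. int (m i)) x) x < \<eta>" by blast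
  define S where "S = (\<lambda>E. \<Sum>i\<in>E. int (m i)) ` Pow {..<l}"
  have S: "finite S" "S \<noteq> {}" by (auto simp: S_def)
  \<comment> \<open>The room left below \<open>\<eta>\<close> by the finitely many sums already
    chosen.\<close>
  define \<epsilon> where "\<epsilon> = \<eta> - Max ((\<lambda>s. dist (g s x) x) ` S)"
  have \<epsilon>: "\<epsilon> > 0" "\<And>s. s \<in> S \<Longrightarrow> dist (g s x) x \<le> \<eta> - \<epsilon>"
    using S m(2) by (auto simp: \<epsilon>_def S_def)
  obtain \<zeta> where \<zeta>: "\<zeta> > 0" "\<And>z' s. z' \<in> X \<Longrightarrow> dist z' x < \<zeta> \<Longrightarrow> s \<in> S \<Longrightarrow> dist (g s z') (g s x) < \<epsilon>"
    using finite_equicontinuous[OF S(1) x \<epsilon>(1)] by blast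
  obtain k :: nat where k: "dist (g (int k) (g (int N) x)) x < \<zeta>"
    using forward_dense[OF g_in[OF x, of "int N"] x \<zeta>(1)] by blast
  define m' where "m' = m(l := k + N)"
  have "dist (g (\<Sum>i\<in>E. int (m' i)) x) x < \<eta>" if E: "E \<subseteq> {..<Suc l}" for E
  proof (cases "l \<in> E")
    case False
    then have "E \<subseteq> {..<l}" using E by (auto simp: less_Suc_eq)
    moreover have "(\<Sum>i\<in>E. int (m' i)) = (\<Sum>i\<in>E. int (m i))"
      using False by (intro sum.cong) (auto simp: m'_def)
    ultimately show ?thesis using m(2) by simp
  next
    case True
    define E' where "E' = E - {l}"
    have E': "E' \<subseteq> {..<l}" "finite E'" "E = insert l E'" "l \<notin> E'"
      using E True finite_subset[OF E] by (auto simp: E'_def less_Suc_eq)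
    have "(\<Sum>i\<in>E'. int (m' i)) = (\<Sum>i\<in>E'. int (m i))"
      using E'(4) by (intro sum.cong) (auto simp: m'_def)
    then have sum: "(\<Sum>i\<in>E. int (m' i)) = (\<Sum>i\<in>E'. int (m i)) + (int k + int N)"
      using E' by (simp add: m'_def)
    have sS: "(\<Sum>i\<in>E'. int (m i)) \<in> S" using E'(1) by (simp add: S_def)
    have "dist (g (\<Sum>i\<in>E. int (m' i)) x) (g (\<Sum>i\<in>E'. int (m i)) x) < \<epsilon>"
      unfolding sum g_add using k by (intro \<zeta>(2) sS g_in x)
    then show ?thesis
      using \<epsilon>(2)[OF sS] dist_triangle[of "g (\<Sum>i\<in>E. int (m' i)) x" x "g (\<Sum>i\<in>E'. int (m i)) x"] by simp
  qed
  moreover have "N \<le> m' i" if "i < Suc l" for i using that m(1) by (auto simp: m'_def less_Suc_eq)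
  ultimately show ?case by blast
qed

text \<open>The exponents become positive after adding return times of \<open>x\<close> chosen later and larger.\<close>

lemma face_reach_return_times:
  assumes "face_reach l x y" "x \<in> X" "e > 0"
  obtains p :: "nat \<Rightarrow> nat" where "\<And>i. i < l \<Longrightarrow> 0 < p i"
    "\<And>E. E \<subseteq> {..<l} \<Longrightarrow> E \<noteq> {} \<Longrightarrow> dist (g (int (\<Sum>i\<in>E. p i)) x) y < e"
proof -
  have "e / 2 > 0" using assms(3) by simp
  then obtain n where n: "\<And>E. E \<subseteq> {..<l} \<Longrightarrow> E \<noteq> {} \<Longrightarrow> dist (g (\<Sum>i\<in>E. n i) x) y < e / 2"
    using face_reach_approx[OF assms(1)] by blast
  define J where "J = (\<lambda>E. \<Sum>i\<in>E. n i) ` Pow {..<l}"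
  have "finite J" by (simp add: J_def)
  then obtain \<eta> where \<eta>: "\<eta> > 0" "\<And>z' s. z' \<in> X \<Longrightarrow> dist z' x < \<eta> \<Longrightarrow> s \<in> J \<Longrightarrow> dist (g s z') (g s x) < e / 2"
    using finite_equicontinuous[OF _ assms(2) \<open>e / 2 > 0\<close>] by blast
  \<comment> \<open>Larger than every \<open>\<bar>n i\<bar>\<close>, so a return time from
    \<open>N\<close> on makes the exponent positive.\<close>
  define N where "N = nat (1 + (\<Sum>i<l. \<bar>n i\<bar>))"
  obtain m :: "nat \<Rightarrow> nat" where m: "\<And>i. i < l \<Longrightarrow> N \<le> m i"
    "\<And>E. E \<subseteq> {..<l} \<Longrightarrow> dist (g (\<Sum>i\<in>E. int (m i)) x) x < \<eta>"
    using late_returns[OF assms(2) \<eta>(1), of l N] by blast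
  define p where "p i = nat (n i + int (m i))" for i
  have p: "n i + int (m i) > 0" if "i < l" for i
  proof -
    have "\<bar>n i\<bar> \<le> (\<Sum>i<l. \<bar>n i\<bar>)" using that by (intro member_le_sum) auto
    then have "\<bar>n i\<bar> < int N" by (simp add: N_def)
    then show ?thesis using m(1)[OF that] by linarith
  qed
  show thesis
  proof (rule that)
    show "0 < p i" if "i < l" for i using p[OF that] by (simp add: p_def)
    show "dist (g (int (\<Sum>i\<in>E. p i)) x) y < e" if E: "E \<subseteq> {..<l}" "E \<noteq> {}" for E
    proof -
      have "int (\<Sum>i\<in>E. p i) = (\<Sum>i\<in>E. n i + int (m i))"
        unfolding int_sum using E(1) p by (intro sum.cong) (auto simp: p_def intro: less_imp_le)
      then have eq: "int (\<Sum>i\<in>E. p i) = (\<Sum>i\<in>E. n i) + (\<Sum>i\<in>E. int (m i))" by (simp add: sum.distrib)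
      have "dist (g (int (\<Sum>i\<in>E. p i)) x) (g (\<Sum>i\<in>E. n i) x) < e / 2"
        unfolding eq g_add using E(1) by (intro \<eta>(2) g_in assms(2) m(2)) (auto simp: J_def)
      then show ?thesis using n[OF E] dist_triangle_half_l dist_commute by metis
    qed
  qed
qed

end

section \<open>Sensitivity and regional proximality\<close>

lemma FS_iff: "n \<in> FS p l \<longleftrightarrow> (\<exists>E. E \<subseteq> {..<l} \<and> E \<noteq> {} \<and> n = (\<Sum>i\<in>E. p i))"
  by (auto simp: FS_def)

lemma finite_FS: "finite (FS p l)"
proof -
  have "FS p l \<subseteq> (\<lambda>E. \<Sum>i\<in>E. p i) ` Pow {..<l}" by (auto simp: FS_def)
  then show ?thesis by (rule finite_subset) simp
qed

lemma FS_mono: "l \<le> l' \<Longrightarrow> FS p l \<subseteq> FS p l'"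
proof
  fix n assume "l \<le> l'" "n \<in> FS p l"
  then obtain E where "E \<subseteq> {..<l'}" "E \<noteq> {}" "n = (\<Sum>i\<in>E. p i)"
    unfolding FS_iff by (metis lessThan_subset_iff order.trans)
  then show "n \<in> FS p l'" unfolding FS_iff by blast
qed

text \<open>A finite set of indices gets the colour of its \<open>p\<close>-sum, and the new
  generators are the sums over the blocks; disjointness turns unions of blocks into sums of
  generators.\<close>

lemma folkman_FS:
  assumes "0 < r"
  obtains L where "\<And>p (\<kappa>::nat \<Rightarrow> nat). (\<And>i. i < L \<Longrightarrow> 0 < p i) \<Longrightarrow> (\<And>n. n \<in> FS p L \<Longrightarrow> \<kappa> n < r) \<Longrightarrow>
    \<exists>q c. (\<forall>i<l. 0 < q i) \<and> FS q l \<subseteq> FS p L \<and> (\<forall>n\<in>FS q l. \<kappa> n = c)"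
proof -
  obtain L where L: "\<And>\<kappa>. (\<And>s. \<kappa> s < r) \<Longrightarrow>
    \<exists>D. disjoint_blocks l D \<and> \<Union>(D ` {..<l}) \<subseteq> {..<L} \<and> monochromatic_unions \<kappa> l D"
    by (rule folkman[of r l]) blast
  show thesis
  proof (rule that)
    fix p and \<kappa> :: "nat \<Rightarrow> nat"
    assume p: "\<And>i. i < L \<Longrightarrow> 0 < p i" and \<kappa>: "\<And>n. n \<in> FS p L \<Longrightarrow> \<kappa> n < r"
    \<comment> \<open>Sets without a sum in \<open>FS p L\<close> get the default colour 0, which is
      where \<open>0 < r\<close> enters.\<close>
    define \<mu> where "\<mu> s = (if s \<subseteq> {..<L} \<and> s \<noteq> {} then \<kappa> (\<Sum>j\<in>s. p j) else 0)" for s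
    have "\<mu> s < r" for s
    proof (cases "s \<subseteq> {..<L} \<and> s \<noteq> {}")
      case True
      then have "(\<Sum>j\<in>s. p j) \<in> FS p L" unfolding FS_iff by (intro exI[of _ s]) simp
      from \<kappa>[OF this] show ?thesis using True by (simp add: \<mu>_def)
    next
      case False
      then have "\<mu> s = 0" unfolding \<mu>_def by (rule if_not_P)
      then show ?thesis using assms by simp
    qed
    then have "\<exists>D. disjoint_blocks l D \<and> \<Union>(D ` {..<l}) \<subseteq> {..<L} \<and> monochromatic_unions \<mu> l D" by (rule L)
    then obtain D where D: "disjoint_blocks l D" "\<Union>(D ` {..<l}) \<subseteq> {..<L}" "monochromatic_unions \<mu> l D" by (elim exE conjE)
    obtain c where c: "\<And>E. E \<subseteq> {..<l} \<Longrightarrow> E \<noteq> {} \<Longrightarrow> \<mu> (\<Union>(D ` E)) = c"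
      using D(3) unfolding monochromatic_unions_def by blast
    define q where "q i = (\<Sum>j\<in>D i. p j)" for i
    have DL: "\<Union>(D ` E) \<subseteq> {..<L}" if "E \<subseteq> {..<l}" for E using D(2) that by blast
    have Dfin: "finite (D i)" "D i \<noteq> {}" if "i < l" for i using D(1) that by (auto simp: disjoint_blocks_def)
    have qsum: "(\<Sum>i\<in>E. q i) = (\<Sum>j\<in>\<Union>(D ` E). p j)" if E: "E \<subseteq> {..<l}" for E
      unfolding q_def
    proof (rule sum.UNION_disjoint[symmetric])
      show "finite E" using E by (rule finite_subset) simp
      show "\<forall>i\<in>E. finite (D i)" using Dfin E by blast
      show "\<forall>i\<in>E. \<forall>j\<in>E. i \<noteq> j \<longrightarrow> D i \<inter> D j = {}"
        using D(1) E unfolding disjoint_blocks_def disjoint_family_on_def by blast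
    qed
    have ne: "\<Union>(D ` E) \<noteq> {}" if E: "E \<subseteq> {..<l}" "E \<noteq> {}" for E using Dfin(2) E by blast
    have mem: "n \<in> FS p L \<and> \<kappa> n = c" if "n \<in> FS q l" for n
    proof -
      obtain E where E: "E \<subseteq> {..<l}" "E \<noteq> {}" "n = (\<Sum>i\<in>E. q i)" using \<open>n \<in> FS q l\<close> unfolding FS_iff by blast
      have n: "n = (\<Sum>j\<in>\<Union>(D ` E). p j)" using E(3) qsum[OF E(1)] by simp
      have "\<mu> (\<Union>(D ` E)) = \<kappa> n" unfolding \<mu>_def n using DL[OF E(1)] ne[OF E(1,2)] by simp
      then show ?thesis using c[OF E(1,2)] DL[OF E(1)] ne[OF E(1,2)] n unfolding FS_iff by metis
    qed
    have "0 < q i" if "i < l" for i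
    proof -
      have "D i \<subseteq> {..<L}" using DL[of "{i}"] that by simp
      then show ?thesis unfolding q_def using p by (intro sum_pos Dfin that) auto
    qed
    then show "\<exists>q c. (\<forall>i<l. 0 < q i) \<and> FS q l \<subseteq> FS p L \<and> (\<forall>n\<in>FS q l. \<kappa> n = c)"
      using mem by (intro exI[of _ q] exI[of _ c]) auto
  qed
qed

lemma Baire_compact:
  fixes X :: "'a::metric_space set" and G :: "nat \<Rightarrow> 'a set"
  assumes "compact X" and "\<And>n. openin (top_of_set X) (G n)"
    and dense: "\<And>n V. openin (top_of_set X) V \<Longrightarrow> V \<noteq> {} \<Longrightarrow> G n \<inter> V \<noteq> {}"
    and V: "openin (top_of_set X) V" "V \<noteq> {}"
  obtains x where "x \<in> V" "\<And>n. x \<in> G n"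
proof -
  have cs: "compact_space (top_of_set X)" using assms(1) by (simp add: compact_space_subtopology)
  have hs: "Hausdorff_space (top_of_set X)" by (simp add: Hausdorff_space_subtopology)
  have "top_of_set X closure_of \<Inter>(range G) = topspace (top_of_set X)"
  proof (rule Baire_category)
    show "completely_metrizable_space (top_of_set X) \<or> locally_compact_space (top_of_set X) \<and> regular_space (top_of_set X)"
      using cs hs compact_imp_locally_compact_space compact_Hausdorff_imp_regular_space by blast
    show "openin (top_of_set X) U \<and> top_of_set X closure_of U = topspace (top_of_set X)" if "U \<in> range G" for U
      using that assms(2) dense unfolding dense_intersects_open by blast
  qed simp
  then have "\<Inter>(range G) \<inter> V \<noteq> {}" using V unfolding dense_intersects_open by blast
  then show thesis using that by blast
qed

section \<open>The flow generated by a minimal homeomorphism, its relation and its visit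
  times\<close>

locale minimal_homeomorphism =
  fixes X :: "'a::metric_space set" and T :: "'a \<Rightarrow> 'a"
  assumes tds: "tds X T" and minimal: "minimal_sys X T" and homeo: "\<exists>S. homeomorphism X X T S"
begin

definition S :: "'a \<Rightarrow> 'a" where "S = the_inv_into X T"

lemma T_in: "x \<in> X \<Longrightarrow> T x \<in> X"
  and T_cont: "continuous_on X T" and cpt: "compact X" and X_ne: "X \<noteq> {}"
  using tds by (auto simp: tds_def)

lemma S_props: "x \<in> X \<Longrightarrow> S x \<in> X" "x \<in> X \<Longrightarrow> S (T x) = x" "x \<in> X \<Longrightarrow> T (S x) = x" "continuous_on X S"
proof -
  obtain R where R: "homeomorphism X X T R" using homeo by blast
  have RX: "R x \<in> X" "T (R x) = x" "R (T x) = x" if "x \<in> X" for x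
    using R that unfolding homeomorphism_def by auto
  have inj: "inj_on T X" by (rule inj_on_inverseI[of _ R]) (rule RX(3))
  have SR: "S x = R x" if "x \<in> X" for x
    unfolding S_def by (rule the_inv_into_f_eq[OF inj]) (use RX that in auto)
  show "x \<in> X \<Longrightarrow> S x \<in> X" "x \<in> X \<Longrightarrow> T (S x) = x" using SR RX by simp_all
  show "x \<in> X \<Longrightarrow> S (T x) = x" using SR[of "T x"] RX(3)[of x] T_in by simp
  have "continuous_on X R" using R by (simp add: homeomorphism_def)
  then show "continuous_on X S" using SR continuous_on_cong by metis
qed

lemma funpow_in: "(\<And>x. x \<in> X \<Longrightarrow> f x \<in> X) \<Longrightarrow> x \<in> X \<Longrightarrow> (f ^^ n) x \<in> X"
  by (induction n) auto

lemma tpow_in: "x \<in> X \<Longrightarrow> tpow X T k x \<in> X"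
  unfolding tpow_def S_def[symmetric] using funpow_in[of T] funpow_in[of S] T_in S_props(1) by auto

lemma tpow_nat: "tpow X T (int n) x = (T ^^ n) x"
  by (simp add: tpow_def)

lemma tpow_neg: "tpow X T (- int m) x = (S ^^ m) x"
  by (cases "m = 0") (simp_all add: tpow_def S_def[symmetric])

lemma tpow_plus1: assumes x: "x \<in> X" shows "tpow X T (k + 1) x = T (tpow X T k x)"
proof (cases "0 \<le> k")
  case True
  then have "nat (k + 1) = Suc (nat k)" by simp
  then show ?thesis using True by (simp add: tpow_def)
next
  case False
  define m where "m = nat (- k - 1)"
  have k: "k = - int (Suc m)" using False by (simp add: m_def)
  have "tpow X T k x = S ((S ^^ m) x)" unfolding k tpow_neg by simp
  moreover have "k + 1 = - int m" using k by simp
  then have "tpow X T (k + 1) x = (S ^^ m) x" by (simp add: tpow_neg)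
  moreover have "(S ^^ m) x \<in> X" using S_props(1) x by (rule funpow_in)
  ultimately show ?thesis by (simp add: S_props(3))
qed

lemma tpow_minus1: assumes x: "x \<in> X" shows "tpow X T (k - 1) x = S (tpow X T k x)"
  using tpow_plus1[OF x, of "k - 1"] S_props(2)[OF tpow_in[OF x, of "k - 1"]] by simp

lemma tpow_add: assumes x: "x \<in> X" shows "tpow X T (j + k) x = tpow X T j (tpow X T k x)"
proof (induction j rule: int_induct[where k = 0])
  case base
  then show ?case by (simp add: tpow_def)
next
  case (step1 i)
  have "tpow X T (i + 1 + k) x = T (tpow X T (i + k) x)" using tpow_plus1[OF x, of "i + k"] by (simp add: ac_simps)
  then show ?case using step1 by (simp add: tpow_plus1 tpow_in x)
next
  case (step2 i)
  have "tpow X T (i - 1 + k) x = S (tpow X T (i + k) x)" using tpow_minus1[OF x, of "i + k"] by (simp add: algebra_simps)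
  then show ?case using step2 by (simp add: tpow_minus1 tpow_in x)
qed

lemma tpow_cont: "continuous_on X (tpow X T k)"
proof (induction k rule: int_induct[where k = 0])
  case base
  have "continuous_on X (tpow X T 0) \<longleftrightarrow> continuous_on X (\<lambda>x. x)"
    by (intro continuous_on_cong refl) (simp add: tpow_def)
  then show ?case by simp
next
  case (step1 i)
  have "continuous_on X (\<lambda>x. T (tpow X T i x))"
    by (rule continuous_on_compose2[OF T_cont step1(2)]) (auto intro: tpow_in)
  moreover have "continuous_on X (tpow X T (i + 1)) \<longleftrightarrow> continuous_on X (\<lambda>x. T (tpow X T i x))"
    by (intro continuous_on_cong refl tpow_plus1)
  ultimately show ?case by simp
next
  case (step2 i)
  have "continuous_on X (\<lambda>x. S (tpow X T i x))"
    by (rule continuous_on_compose2[OF S_props(4) step2(2)]) (auto intro: tpow_in)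
  moreover have "continuous_on X (tpow X T (i - 1)) \<longleftrightarrow> continuous_on X (\<lambda>x. S (tpow X T i x))"
    by (intro continuous_on_cong refl tpow_minus1)
  ultimately show ?case by simp
qed

definition act :: "int \<Rightarrow> 'a \<Rightarrow> 'a" where "act k x = (if x \<in> X then tpow X T k x else x)"

lemma act_nat: "x \<in> X \<Longrightarrow> act (int n) x = (T ^^ n) x"
  by (simp add: act_def tpow_nat)

sublocale minimal_flow X act
proof
  show "act (j + k) x = act j (act k x)" for j k x by (simp add: act_def tpow_add tpow_in)
  have "continuous_on X (act k) \<longleftrightarrow> continuous_on X (tpow X T k)" for k
    by (intro continuous_on_cong refl) (simp add: act_def)
  then show "continuous_on X (act k)" for k using tpow_cont by simp
  show "\<exists>k. dist (act (int k) x) y < e" if "x \<in> X" "y \<in> X" "e > 0" for x y e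
  proof -
    have "y \<in> closure {(T ^^ n) x | n. True}" using minimal that unfolding minimal_sys_def by blast
    then obtain z where "z \<in> {(T ^^ n) x | n. True}" "dist z y < e"
      using \<open>e > 0\<close> unfolding closure_approachable by blast
    then show ?thesis using act_nat[OF \<open>x \<in> X\<close>] by auto
  qed
qed (use cpt tpow_in in \<open>auto simp: act_def tpow_def\<close>)

lemma Tn_in: "x \<in> X \<Longrightarrow> (T ^^ n) x \<in> X"
  using T_in by (rule funpow_in)

lemma Tn_cont: "continuous_on X (T ^^ n)"
proof -
  have "continuous_on X (act (int n)) \<longleftrightarrow> continuous_on X (T ^^ n)"
    by (intro continuous_on_cong refl) (simp add: act_nat)
  then show ?thesis using g_cont by simp
qed

lemma RP_iff: "(x, y) \<in> RP X T d \<longleftrightarrow> reg_prox d x y"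
proof -
  have "(\<exists>y'\<in>X. \<exists>n. dist x x' < \<delta> \<and> dist y y' < \<delta> \<and> (\<forall>E. E \<subseteq> {..<d} \<and> E \<noteq> {} \<longrightarrow>
         dist (tpow X T (\<Sum>i\<in>E. n i) x') (tpow X T (\<Sum>i\<in>E. n i) y') < \<delta>)) \<longleftrightarrow>
     (\<exists>y'\<in>X. \<exists>n. dist x x' < \<delta> \<and> dist y y' < \<delta> \<and> (\<forall>E. E \<subseteq> {..<d} \<and> E \<noteq> {} \<longrightarrow>
         dist (act (\<Sum>i\<in>E. n i) x') (act (\<Sum>i\<in>E. n i) y') < \<delta>))" if "x' \<in> X" for \<delta> x'
    using that by (intro bex_cong refl) (simp add: act_def)
  then show ?thesis unfolding RP_def reg_prox_def by simp
qed

lemma RP_inf_iff: "(x, y) \<in> RP_inf X T \<longleftrightarrow> (\<forall>d. reg_prox d x y)"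
proof
  assume "(x, y) \<in> RP_inf X T"
  then have rp: "reg_prox d x y" if "d \<ge> 1" for d using that RP_iff unfolding RP_inf_def by blast
  have "reg_prox 0 x y"
    using rp[of 1] unfolding reg_prox_def by auto
  then show "\<forall>d. reg_prox d x y" using rp by (metis One_nat_def Suc_leI neq0_conv)
qed (auto simp: RP_inf_def RP_iff)

lemma RP_inf_in: "(x, y) \<in> RP_inf X T \<Longrightarrow> x \<in> X \<and> y \<in> X"
  unfolding RP_inf_iff reg_prox_def by blast

lemma RP_inf_refl: "x \<in> X \<Longrightarrow> (x, x) \<in> RP_inf X T"
  unfolding RP_inf_iff reg_prox_def by (auto intro!: bexI[of _ x] exI[of _ "\<lambda>_. 0"])

lemma RP_inf_sym: "(x, y) \<in> RP_inf X T \<Longrightarrow> (y, x) \<in> RP_inf X T"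
  unfolding RP_inf_iff using reg_prox_sym by blast

lemma RP_inf_trans: "(x, y) \<in> RP_inf X T \<Longrightarrow> (y, z) \<in> RP_inf X T \<Longrightarrow> (x, z) \<in> RP_inf X T"
  unfolding RP_inf_iff using reg_prox_inf_trans by blast

lemma nil_factor_map_eq: "(x, y) \<in> RP_inf X T \<Longrightarrow> nil_factor_map X T y = nil_factor_map X T x"
  unfolding nil_factor_map_def using RP_inf_sym RP_inf_trans by blast

lemma closed_RP_inf: "closed (RP_inf X T)"
proof -
  have "RP_inf X T = (\<Inter>d. {p. reg_prox d (fst p) (snd p)})" using RP_inf_iff by auto
  then show ?thesis using closed_reg_prox by (simp add: closed_INT)
qed

lemma return_sets:
  assumes "(x, y) \<in> RP_inf X T" "e > 0"
  obtains p where "\<And>i. i < l \<Longrightarrow> 0 < p i" "\<And>n. n \<in> FS p l \<Longrightarrow> dist ((T ^^ n) x) y < e"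
proof -
  have "face_reach l x y" using assms(1) unfolding RP_inf_iff by (intro reg_prox_face_reach) blast
  moreover have x: "x \<in> X" using RP_inf_in assms(1) by blast
  ultimately obtain p where p: "\<And>i. i < l \<Longrightarrow> 0 < p i"
    "\<And>E. E \<subseteq> {..<l} \<Longrightarrow> E \<noteq> {} \<Longrightarrow> dist (act (int (\<Sum>i\<in>E. p i)) x) y < e"
    using assms(2) by (rule face_reach_return_times) blast
  have "dist ((T ^^ n) x) y < e" if n: "n \<in> FS p l" for n
  proof -
    obtain E where E: "E \<subseteq> {..<l}" "E \<noteq> {}" "n = (\<Sum>i\<in>E. p i)" using n unfolding FS_iff by blast
    show ?thesis using p(2)[OF E(1,2)] unfolding E(3)[symmetric] act_nat[OF x] .
  qed
  with p(1) show thesis by (rule that)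
qed

lemma openin_preimage:
  assumes "openin (top_of_set X) W" shows "openin (top_of_set X) {x \<in> X. (T ^^ n) x \<in> W}"
proof -
  have "openin (top_of_set X) (X \<inter> (T ^^ n) -` W)"
    by (rule continuous_openin_preimage[OF Tn_cont _ assms]) (auto intro: Tn_in)
  then show ?thesis by (simp add: vimage_def Int_def)
qed

text \<open>By minimality the preimages of \<open>W\<close> cover \<open>X\<close>; a finite
  subcover bounds the waiting time uniformly.\<close>

lemma syndetic_visits:
  assumes W: "openin (top_of_set X) W" "W \<noteq> {}"
  obtains M where "\<And>z. z \<in> X \<Longrightarrow> \<exists>i<M. (T ^^ i) z \<in> W"
proof -
  define C where "C = range (\<lambda>i. {x \<in> X. (T ^^ i) x \<in> W})"
  have "X \<subseteq> \<Union>C"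
  proof
    fix z assume z: "z \<in> X"
    obtain w where w: "w \<in> W" using W(2) by blast
    obtain e where e: "e > 0" "ball w e \<inter> X \<subseteq> W" "w \<in> X"
      using W(1) w by (metis openin_contains_ball subsetD)
    obtain k :: nat where "dist (act (int k) z) w < e" using forward_dense[OF z e(3,1)] by blast
    then have "(T ^^ k) z \<in> W" using e(2) Tn_in[OF z] act_nat[OF z] by (auto simp: dist_commute)
    then show "z \<in> \<Union>C" using z by (auto simp: C_def)
  qed
  moreover have "\<forall>c\<in>C. openin (top_of_set X) c" using openin_preimage[OF W(1)] by (auto simp: C_def)
  ultimately obtain D where D: "D \<subseteq> C" "finite D" "X \<subseteq> \<Union>D"
    using cpt unfolding compact_eq_openin_cover by meson
  obtain I where I: "finite I" "D = (\<lambda>i. {x \<in> X. (T ^^ i) x \<in> W}) ` I"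
    using finite_subset_image[OF D(2) D(1)[unfolded C_def]] by blast
  obtain M where M: "\<forall>i\<in>I. i < M" using I(1) finite_nat_set_iff_bounded by blast
  show thesis
  proof (rule that)
    fix z assume "z \<in> X"
    then have "z \<in> \<Union>D" using D(3) by blast
    then obtain i where "i \<in> I" "(T ^^ i) z \<in> W" unfolding I(2) by blast
    then show "\<exists>i<M. (T ^^ i) z \<in> W" using M by blast
  qed
qed

section \<open>The cycle of implications between (1), (2) and (3)\<close>

text \<open>Whenever the orbits of \<open>a\<close> and \<open>b\<close> are \<open>\<delta>\<close>
  apart, one of them is \<open>\<delta> / 2\<close> away from that of \<open>x\<close>. Partition
  regularity makes the choice constant along an IP-set of length \<open>l\<close>; it may vary with
  \<open>l\<close>, which block sensitivity permits.\<close>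

lemma sensitive_imp_block:
  assumes "strongly_F_sensitive F_fip X T" shows "block_Fip_sensitive X T"
proof -
  obtain \<delta> where \<delta>: "\<delta> > 0" and sens: "\<And>U. openin (top_of_set X) U \<Longrightarrow> U \<noteq> {} \<Longrightarrow>
      \<exists>x\<in>U. \<exists>y\<in>U. {n. dist ((T ^^ n) x) ((T ^^ n) y) > \<delta>} \<in> F_fip"
    using assms unfolding strongly_F_sensitive_def by blast
  have "\<exists>y\<in>U. contains_fip {n. dist ((T ^^ n) x) ((T ^^ n) y) > \<delta> / 2} l"
    if U: "openin (top_of_set X) U" "x \<in> U" for x U l
  proof -
    obtain a b where ab: "a \<in> U" "b \<in> U" "{n. dist ((T ^^ n) a) ((T ^^ n) b) > \<delta>} \<in> F_fip"
      using sens[OF U(1)] U(2) by blast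
    obtain L where L: "\<And>p (\<kappa>::nat \<Rightarrow> nat). (\<And>i. i < L \<Longrightarrow> 0 < p i) \<Longrightarrow> (\<And>n. n \<in> FS p L \<Longrightarrow> \<kappa> n < 2) \<Longrightarrow>
      \<exists>q c. (\<forall>i<l. 0 < q i) \<and> FS q l \<subseteq> FS p L \<and> (\<forall>n\<in>FS q l. \<kappa> n = c)"
      using folkman_FS[of 2 l] by (metis pos2)
    obtain p where p: "\<forall>i<L. 0 < p i" "FS p L \<subseteq> {n. dist ((T ^^ n) a) ((T ^^ n) b) > \<delta>}"
      using ab(3) unfolding F_fip_def contains_fip_def by blast
    define \<kappa> :: "nat \<Rightarrow> nat" where "\<kappa> n = (if dist ((T ^^ n) x) ((T ^^ n) a) > \<delta> / 2 then 0 else 1)" for n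
    obtain q c where q: "\<forall>i<l. 0 < q i" "FS q l \<subseteq> FS p L" "\<forall>n\<in>FS q l. \<kappa> n = c"
    proof -
      have "\<kappa> n < 2" for n by (simp add: \<kappa>_def)
      then show thesis using L[of p \<kappa>] p(1) that by blast
    qed
    show ?thesis
    proof (cases "c = 0")
      case True
      then have "FS q l \<subseteq> {n. dist ((T ^^ n) x) ((T ^^ n) a) > \<delta> / 2}"
        using q(3) by (auto simp: \<kappa>_def split: if_splits)
      then show ?thesis using q(1) ab(1) unfolding contains_fip_def by blast
    next
      case False
      have "dist ((T ^^ n) x) ((T ^^ n) b) > \<delta> / 2" if n: "n \<in> FS q l" for n
      proof -
        have "dist ((T ^^ n) x) ((T ^^ n) a) \<le> \<delta> / 2"
          using q(3) n False by (auto simp: \<kappa>_def split: if_splits)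
        moreover have "dist ((T ^^ n) a) ((T ^^ n) b) > \<delta>" using p(2) q(2) n by blast
        ultimately show ?thesis
          using dist_triangle3[of "(T ^^ n) a" "(T ^^ n) b" "(T ^^ n) x"] by simp
      qed
      then show ?thesis using q(1) ab(2) unfolding contains_fip_def by blast
    qed
  qed
  then show ?thesis unfolding block_Fip_sensitive_def using \<delta> half_gt_zero by blast
qed

text \<open>Colouring times by the \<open>e\<close>-cells of \<open>T^n x\<close> and
  \<open>T^n y\<close> freezes both orbits near centres \<open>z\<close> and \<open>w\<close> along
  a sub-IP-set. These are more than \<open>\<delta> - 2 * e\<close> apart, so one of them is far
  from \<open>x\<close>; it serves as \<open>v\<close>, with \<open>x'\<close> being
  \<open>x\<close> or \<open>y\<close> accordingly.\<close>

lemma block_step: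
  assumes U: "\<And>l. l \<ge> 1 \<Longrightarrow> \<exists>y\<in>U. contains_fip {n. dist ((T ^^ n) x) ((T ^^ n) y) > \<delta>} l"
    and x: "x \<in> X" "x \<in> U" "U \<subseteq> X" and e: "e > 0"
  shows "\<exists>v\<in>X. \<exists>x'\<in>U. \<delta> / 2 - e \<le> dist x v \<and> (\<exists>q. \<forall>n\<in>FS q (Suc k). dist ((T ^^ n) x') v < e)"
proof -
  have "seq_compact X" using cpt compact_eq_seq_compact_metric by blast
  then obtain C where C: "finite C" "C \<subseteq> X" "X \<subseteq> (\<Union>c\<in>C. ball c e)"
    using seq_compact_imp_totally_bounded e by metis
  define r where "r = card C"
  obtain c where c: "bij_betw c {0..<r} C" using ex_bij_betw_nat_finite[OF C(1)] unfolding r_def by blast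
  have cX: "c i \<in> X" if "i < r" for i using c that C(2) bij_betwE by fastforce
  define idx where "idx z = (SOME i. i < r \<and> dist z (c i) < e)" for z
  have idx: "idx z < r \<and> dist z (c (idx z)) < e" if "z \<in> X" for z
    unfolding idx_def
  proof (rule someI_ex)
    obtain w where w: "w \<in> C" "z \<in> ball w e" using C(3) \<open>z \<in> X\<close> by blast
    obtain i where "i \<in> {0..<r}" "w = c i" using c w(1) by (metis bij_betw_imp_surj_on imageE)
    then show "\<exists>i. i < r \<and> dist z (c i) < e" using w(2) by (auto simp: dist_commute)
  qed
  have r: "0 < r" using idx[OF x(1)] by linarith
  then have "0 < r * r" by simp
  then obtain L where L: "\<And>p (\<kappa>::nat \<Rightarrow> nat). (\<And>i. i < L \<Longrightarrow> 0 < p i) \<Longrightarrow> (\<And>n. n \<in> FS p L \<Longrightarrow> \<kappa> n < r * r) \<Longrightarrow>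
      \<exists>q c. (\<forall>i<Suc k. 0 < q i) \<and> FS q (Suc k) \<subseteq> FS p L \<and> (\<forall>n\<in>FS q (Suc k). \<kappa> n = c)"
    using folkman_FS[of "r * r" "Suc k"] by metis
  \<comment> \<open>One generator more than \<open>L\<close>, since the hypothesis asks for length
    at least 1.\<close>
  obtain y p where y: "y \<in> U" and p: "\<forall>i<Suc L. 0 < p i" "FS p (Suc L) \<subseteq> {n. dist ((T ^^ n) x) ((T ^^ n) y) > \<delta>}"
    using U[of "Suc L"] unfolding contains_fip_def by auto
  have yX: "y \<in> X" using y x(3) by blast
  define \<kappa> where "\<kappa> n = idx ((T ^^ n) x) * r + idx ((T ^^ n) y)" for n
  have \<kappa>_lt: "\<kappa> n < r * r" for n
  proof -
    have "\<kappa> n < idx ((T ^^ n) x) * r + r" using idx[OF Tn_in[OF yX]] by (simp add: \<kappa>_def)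
    also have "\<dots> = Suc (idx ((T ^^ n) x)) * r" by simp
    also have "\<dots> \<le> r * r" using idx[OF Tn_in[OF x(1)], of n] by (intro mult_right_mono) (auto simp: Suc_le_eq)
    finally show ?thesis .
  qed
  obtain q b where q: "FS q (Suc k) \<subseteq> FS p L" "\<forall>n\<in>FS q (Suc k). \<kappa> n = b"
    using L[of p \<kappa>] p(1) \<kappa>_lt by auto
  define z where "z = c (b div r)"
  define w where "w = c (b mod r)"
  have near: "dist ((T ^^ n) x) z < e" "dist ((T ^^ n) y) w < e" "b div r < r" "b mod r < r"
    if n: "n \<in> FS q (Suc k)" for n
  proof -
    have b: "b = idx ((T ^^ n) x) * r + idx ((T ^^ n) y)" using q(2) n by (simp add: \<kappa>_def)
    have "idx ((T ^^ n) y) < r" using idx[OF Tn_in[OF yX]] by blast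
    then have "b div r = idx ((T ^^ n) x)" "b mod r = idx ((T ^^ n) y)" unfolding b by simp_all
    then show "dist ((T ^^ n) x) z < e" "dist ((T ^^ n) y) w < e" "b div r < r" "b mod r < r"
      using idx[OF Tn_in[OF x(1)], of n] idx[OF Tn_in[OF yX], of n] by (simp_all add: z_def w_def)
  qed
  \<comment> \<open>The length \<open>Suc k\<close> ensures that a time exists at all, so that
    \<open>z\<close> and \<open>w\<close> are genuine centres and their distance can be
    bounded.\<close>
  have n0: "q 0 \<in> FS q (Suc k)" unfolding FS_iff by (intro exI[of _ "{0}"]) auto
  then have "q 0 \<in> FS p (Suc L)" using q(1) FS_mono[of L "Suc L" p] by auto
  then have "dist ((T ^^ q 0) x) ((T ^^ q 0) y) > \<delta>" using p(2) by blast
  then have "\<delta> < dist z w + 2 * e"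
    using near(1,2)[OF n0] dist_triangle[of "(T ^^ q 0) x" "(T ^^ q 0) y" z]
      dist_triangle2[of z "(T ^^ q 0) y" w] by simp
  then have "\<delta> / 2 - e \<le> dist x z \<or> \<delta> / 2 - e \<le> dist x w"
    using dist_triangle3[of z w x] by linarith
  moreover have "z \<in> X" "w \<in> X" using near(3,4)[OF n0] cX by (simp_all add: z_def w_def)
  ultimately show ?thesis using near(1,2) y x(2) by blast
qed

text \<open>The points \<open>v k\<close> obtained at scale \<open>1 / real (Suc k)\<close>
  accumulate at the partner \<open>y\<close>. Points tending to \<open>x\<close> visit
  \<open>y\<close> ever more closely along IP-sets of growing length, which is the criterion
  \<open>reg_proxI\<close> for every order.\<close>

lemma block_imp_far:
  assumes "block_Fip_sensitive X T"
  shows "\<exists>\<delta>>0. \<forall>x\<in>X. \<exists>y\<in>X. (x, y) \<in> RP_inf X T \<and> dist x y \<ge> \<delta>"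
proof -
  obtain \<delta> where \<delta>: "\<delta> > 0" and sens: "\<forall>x\<in>X. \<forall>U. openin (top_of_set X) U \<and> x \<in> U \<longrightarrow>
      (\<forall>l\<ge>1. \<exists>y\<in>U. contains_fip {n. dist ((T ^^ n) x) ((T ^^ n) y) > \<delta>} l)"
    using assms unfolding block_Fip_sensitive_def by (elim exE conjE)
  have "\<exists>y\<in>X. (x, y) \<in> RP_inf X T \<and> dist x y \<ge> \<delta> / 2" if x: "x \<in> X" for x
  proof -
    define e where "e k = 1 / real (Suc k)" for k
    have e: "e k > 0" for k by (simp add: e_def)
    have e0: "e \<longlonglongrightarrow> 0" unfolding e_def using LIMSEQ_inverse_real_of_nat by (simp add: inverse_eq_divide)
    have "\<exists>v x' q. v \<in> X \<and> x' \<in> X \<and> dist x x' < e k \<and> \<delta> / 2 - e k \<le> dist x v \<and>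
        (\<forall>n\<in>FS q (Suc k). dist ((T ^^ n) x') v < e k)" for k
    proof -
      define U where "U = X \<inter> ball x (e k)"
      have "openin (top_of_set X) U" "x \<in> U" unfolding U_def using e x by (auto simp: openin_open_Int)
      then have "\<exists>v\<in>X. \<exists>x'\<in>U. \<delta> / 2 - e k \<le> dist x v \<and> (\<exists>q. \<forall>n\<in>FS q (Suc k). dist ((T ^^ n) x') v < e k)"
        using bspec[OF sens x] by (intro block_step x e) (auto simp: U_def)
      then obtain v x' q where "v \<in> X" "x' \<in> U" "\<delta> / 2 - e k \<le> dist x v"
        "\<forall>n\<in>FS q (Suc k). dist ((T ^^ n) x') v < e k" by blast
      moreover have "x' \<in> X" "dist x x' < e k" using \<open>x' \<in> U\<close> by (auto simp: U_def)
      ultimately show ?thesis by blast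
    qed
    then obtain v x' q where v: "\<And>k. v k \<in> X" and x': "\<And>k. x' k \<in> X" "\<And>k. dist x (x' k) < e k"
      and far: "\<And>k. \<delta> / 2 - e k \<le> dist x (v k)"
      and near: "\<And>k n. n \<in> FS (q k) (Suc k) \<Longrightarrow> dist ((T ^^ n) (x' k)) (v k) < e k" by metis
    obtain y s where y: "y \<in> X" "strict_mono s" "(v \<circ> s) \<longlonglongrightarrow> y"
      using cpt v unfolding compact_eq_seq_compact_metric seq_compact_def by meson
    have es: "(\<lambda>m. e (s m)) \<longlonglongrightarrow> 0" using LIMSEQ_subseq_LIMSEQ[OF e0 y(2)] by (simp add: o_def)
    have "(\<lambda>m. \<delta> / 2 - e (s m)) \<longlonglongrightarrow> \<delta> / 2 - 0" by (intro tendsto_intros es)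
    moreover have "(\<lambda>m. dist x (v (s m))) \<longlonglongrightarrow> dist x y"
      using y(3) by (intro tendsto_dist tendsto_const) (simp add: o_def)
    ultimately have "\<delta> / 2 - 0 \<le> dist x y" by (rule LIMSEQ_le) (use far in auto)
    moreover have "reg_prox d x y" for d
    proof (rule reg_proxI[OF x y(1)])
      fix \<epsilon> :: real assume "\<epsilon> > 0"
      then have "\<epsilon> / 2 > 0" by simp
      have "\<forall>\<^sub>F m in sequentially. e (s m) < \<epsilon> / 2" using es \<open>\<epsilon> / 2 > 0\<close> by (rule order_tendstoD)
      moreover have "\<forall>\<^sub>F m in sequentially. dist (v (s m)) y < \<epsilon> / 2"
        using tendstoD[OF y(3) \<open>\<epsilon> / 2 > 0\<close>] by (simp add: o_def)
      ultimately have "\<forall>\<^sub>F m in sequentially. e (s m) < \<epsilon> / 2 \<and> dist (v (s m)) y < \<epsilon> / 2 \<and> d \<le> m"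
        using eventually_ge_at_top[of d] by eventually_elim simp
      then obtain m where m: "e (s m) < \<epsilon> / 2" "dist (v (s m)) y < \<epsilon> / 2" "d \<le> m"
        using eventually_happens'[OF sequentially_bot] by blast
      define k where "k = s m"
      have dk: "Suc d \<le> Suc k" using m(3) seq_suble[OF y(2), of m] by (simp add: k_def)
      have "dist (act (\<Sum>i\<in>E. int (q k i)) (x' k)) y < \<epsilon>" if E: "E \<subseteq> {..<Suc d}" "E \<noteq> {}" for E
      proof -
        have "(\<Sum>i\<in>E. q k i) \<in> FS (q k) (Suc d)" unfolding FS_iff using E by blast
        then have "(\<Sum>i\<in>E. q k i) \<in> FS (q k) (Suc k)" using FS_mono[OF dk] by blast
        from near[OF this] have "dist (act (\<Sum>i\<in>E. int (q k i)) (x' k)) (v k) < e k"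
          using act_nat[OF x'(1)] by (metis of_nat_sum)
        then show ?thesis using m(1,2) dist_triangle[of "act (\<Sum>i\<in>E. int (q k i)) (x' k)" y "v k"]
          by (simp add: k_def)
      qed
      moreover have "dist x (x' k) < \<epsilon>" using x'(2)[of k] m(1) \<open>\<epsilon> > 0\<close> by (simp add: k_def)
      ultimately show "\<exists>x'\<in>X. dist x x' < \<epsilon> \<and>
         (\<exists>n. \<forall>E. E \<subseteq> {..<Suc d} \<and> E \<noteq> {} \<longrightarrow> dist (act (\<Sum>i\<in>E. n i) x') y < \<epsilon>)"
        using x'(1) by (intro bexI[of _ "x' k"] conjI exI[of _ "\<lambda>i. int (q k i)"]) auto
    qed
    ultimately show ?thesis using y(1) by (auto simp: RP_inf_iff)
  qed
  then show ?thesis using \<delta> by (intro exI[of _ "\<delta> / 2"]) auto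
qed

text \<open>Colouring the finite IP-set by the visit time to \<open>W\<close> of a fixed orbit gives a sub-IP-set along
  which some point of \<open>W\<close> returns to \<open>W\<close>.\<close>

lemma common_return:
  assumes W: "openin (top_of_set X) W" "W \<noteq> {}" and xy: "(x, y) \<in> RP_inf X T" and e: "e > 0"
  obtains c q where "c \<in> W" "\<And>i. i < l \<Longrightarrow> 0 < q i" "\<And>n. n \<in> FS q l \<Longrightarrow> dist ((T ^^ n) x) y < e"
    "\<And>n. n \<in> FS q l \<Longrightarrow> (T ^^ n) c \<in> W"
proof -
  obtain M where M: "\<And>z. z \<in> X \<Longrightarrow> \<exists>i<M. (T ^^ i) z \<in> W" using syndetic_visits[OF W] by blast
  have x: "x \<in> X" using RP_inf_in xy by blast
  define vis where "vis n = (SOME i. i < M \<and> (T ^^ i) ((T ^^ n) x) \<in> W)" for n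
  have vis: "vis n < M \<and> (T ^^ vis n) ((T ^^ n) x) \<in> W" for n
    unfolding vis_def using M[OF Tn_in[OF x]] by (rule someI_ex)
  have "0 < M" using M[OF x] by auto
  then obtain L where L: "\<And>p (\<kappa>::nat \<Rightarrow> nat). (\<And>i. i < L \<Longrightarrow> 0 < p i) \<Longrightarrow> (\<And>n. n \<in> FS p L \<Longrightarrow> \<kappa> n < M) \<Longrightarrow>
      \<exists>q c. (\<forall>i<Suc l. 0 < q i) \<and> FS q (Suc l) \<subseteq> FS p L \<and> (\<forall>n\<in>FS q (Suc l). \<kappa> n = c)"
    using folkman_FS[of M "Suc l"] by metis
  obtain p where p: "\<And>i. i < L \<Longrightarrow> 0 < p i" "\<And>n. n \<in> FS p L \<Longrightarrow> dist ((T ^^ n) x) y < e"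
    using return_sets[OF xy e, of L] by metis
  obtain q i where q: "\<forall>i<Suc l. 0 < q i" "FS q (Suc l) \<subseteq> FS p L" "\<forall>n\<in>FS q (Suc l). vis n = i"
    using L[of p vis] p(1) vis by blast
  \<comment> \<open>The surplus generator \<open>q l\<close> is spent on the base point: for
    \<open>n\<close> in \<open>FS q l\<close> both \<open>q l\<close> and \<open>n + q l\<close> lie
    in \<open>FS q (Suc l)\<close>, so the same delay \<open>i\<close> puts \<open>c\<close> and its
    image into \<open>W\<close>.\<close>
  define c where "c = (T ^^ i) ((T ^^ q l) x)"
  have iW: "(T ^^ i) ((T ^^ n) x) \<in> W" if "n \<in> FS q (Suc l)" for n using vis[of n] q(3) that by auto
  show thesis
  proof (rule that)
    have "q l \<in> FS q (Suc l)" unfolding FS_iff by (intro exI[of _ "{l}"]) auto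
    then show "c \<in> W" unfolding c_def by (rule iW)
    show "0 < q i" if "i < l" for i using q(1) that by simp
    fix n assume n: "n \<in> FS q l"
    then show "dist ((T ^^ n) x) y < e" using q(2) p(2) FS_mono[of l "Suc l" q] by auto
    obtain E where E: "E \<subseteq> {..<l}" "E \<noteq> {}" "n = (\<Sum>i\<in>E. q i)" using n unfolding FS_iff by blast
    have "finite E" "l \<notin> E" using E(1) by (auto intro: finite_subset)
    then have "n + q l = (\<Sum>i\<in>insert l E. q i)" using E(3) by simp
    then have "n + q l \<in> FS q (Suc l)" unfolding FS_iff using E(1) by (intro exI[of _ "insert l E"]) auto
    from iW[OF this] have "(T ^^ (i + (n + q l))) x \<in> W" by (simp add: funpow_add)
    moreover have "i + (n + q l) = n + (i + q l)" by simp
    ultimately have "(T ^^ (n + (i + q l))) x \<in> W" by simp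
    then show "(T ^^ n) c \<in> W" by (simp add: c_def funpow_add)
  qed
qed

text \<open>The sensitive pair is \<open>x\<close> and a generic \<open>c\<close> near it: along
  suitable IP-sets \<open>x\<close> moves near \<open>y\<close> while \<open>c\<close> returns near
  \<open>x\<close>. Lemma \<open>common_return\<close> gives such a \<open>c\<close> for each single
  length, and genericity merges the lengths.\<close>

lemma far_imp_sensitive:
  assumes "\<exists>\<delta>>0. \<forall>x\<in>X. \<exists>y\<in>X. (x, y) \<in> RP_inf X T \<and> dist x y \<ge> \<delta>"
  shows "strongly_F_sensitive F_fip X T"
proof -
  obtain \<delta> where \<delta>: "\<delta> > 0" and far: "\<And>x. x \<in> X \<Longrightarrow> \<exists>y\<in>X. (x, y) \<in> RP_inf X T \<and> dist x y \<ge> \<delta>"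
    using assms by blast
  have "\<exists>x\<in>U. \<exists>y\<in>U. {n. dist ((T ^^ n) x) ((T ^^ n) y) > \<delta> / 2} \<in> F_fip"
    if U: "openin (top_of_set X) U" "U \<noteq> {}" for U
  proof -
    obtain x where xU: "x \<in> U" using U(2) by blast
    have x: "x \<in> X" using openin_imp_subset[OF U(1)] xU by blast
    obtain y where y: "(x, y) \<in> RP_inf X T" "dist x y \<ge> \<delta>" using far[OF x] by blast
    \<comment> \<open>Two errors below \<open>e\<close> are subtracted from \<open>dist x y\<close>,
      and more than \<open>\<delta> / 2\<close> must remain.\<close>
    define e where "e = \<delta> / 8"
    have e: "e > 0" using \<delta> by (simp add: e_def)
    define W where "W = U \<inter> (X \<inter> ball x e)"
    have W: "openin (top_of_set X) W" unfolding W_def by (intro openin_Int U(1) openin_open_Int) simp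
    have xW: "x \<in> W" using xU x e by (simp add: W_def)
    define good where "good l p \<longleftrightarrow> (\<forall>i<l. 0 < p i) \<and> (\<forall>n\<in>FS p l. dist ((T ^^ n) x) y < e)" for l p
    define G where "G l = (\<Union>p\<in>{p. good l p}. (\<Inter>n\<in>FS p l. {c \<in> X. (T ^^ n) c \<in> W}) \<inter> X)" for l
    \<comment> \<open>The Baire argument runs in all of \<open>X\<close>, while \<open>G l\<close>
      is shown dense only in \<open>W\<close>; the exterior of \<open>W\<close> is added for density
      and drops out again because \<open>c \<in> W\<close>.\<close>
    define G' where "G' l = G l \<union> (X - closure W)" for l
    have GI: "openin (top_of_set X) (G l)" for l
    proof -
      have "openin (top_of_set X) ((\<Inter>n\<in>FS p l. {c \<in> X. (T ^^ n) c \<in> W}) \<inter> topspace (top_of_set X))" for p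
        by (intro openin_INT finite_FS openin_preimage W)
      then have "openin (top_of_set X) ((\<Inter>n\<in>FS p l. {c \<in> X. (T ^^ n) c \<in> W}) \<inter> X)" for p by simp
      then show ?thesis unfolding G_def by (intro openin_Union) auto
    qed
    have "openin (top_of_set X) (G' l)" for l
      unfolding G'_def Diff_eq by (intro openin_Un GI openin_open_Int open_Compl closed_closure)
    moreover have "G' l \<inter> V \<noteq> {}" if V: "openin (top_of_set X) V" "V \<noteq> {}" for l V
    proof (cases "V \<inter> W = {}")
      case True
      obtain z where z: "z \<in> V" using V(2) by blast
      have VX: "V \<subseteq> X" using openin_imp_subset[OF V(1)] .
      obtain d where d: "d > 0" "ball z d \<inter> X \<subseteq> V" using V(1) z by (metis openin_contains_ball)
      have "z \<notin> closure W"
      proof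
        assume "z \<in> closure W"
        then obtain w where "w \<in> W" "dist w z < d" using d(1) unfolding closure_approachable by blast
        then have "w \<in> V \<inter> W" using d(2) by (auto simp: W_def dist_commute)
        then show False using True by blast
      qed
      then show ?thesis using z VX by (auto simp: G'_def)
    next
      case False
      have "openin (top_of_set X) (V \<inter> W)" using V(1) W by (rule openin_Int)
      then obtain c q where c: "c \<in> V \<inter> W" "\<And>i. i < l \<Longrightarrow> 0 < q i" "\<And>n. n \<in> FS q l \<Longrightarrow> dist ((T ^^ n) x) y < e"
        "\<And>n. n \<in> FS q l \<Longrightarrow> (T ^^ n) c \<in> V \<inter> W"
        using common_return[OF _ False y(1) e, of l] by metis
      have "c \<in> X" using c(1) by (simp add: W_def)
      moreover have "good l q" using c(2,3) by (simp add: good_def)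
      ultimately have "c \<in> G l" using c(4) unfolding G_def by blast
      then show ?thesis using c(1) by (auto simp: G'_def)
    qed
    ultimately obtain c where c: "c \<in> W" "\<And>l. c \<in> G' l"
      using xW by (elim Baire_compact[OF cpt _ _ W]) auto
    have cG: "c \<in> G l" for l using c(2)[of l] c(1) closure_subset by (auto simp: G'_def)
    have "contains_fip {n. dist ((T ^^ n) x) ((T ^^ n) c) > \<delta> / 2} l" for l
    proof -
      obtain p where p: "good l p" "\<And>n. n \<in> FS p l \<Longrightarrow> (T ^^ n) c \<in> W"
        using cG[of l] unfolding G_def by blast
      have "dist ((T ^^ n) x) ((T ^^ n) c) > \<delta> / 2" if n: "n \<in> FS p l" for n
      proof -
        have "dist x ((T ^^ n) c) < e" using p(2)[OF n] by (simp add: W_def)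
        moreover have "dist ((T ^^ n) x) y < e" using p(1) n by (simp add: good_def)
        ultimately show ?thesis
          using y(2) \<delta> dist_triangle[of x y "(T ^^ n) c"] dist_triangle3[of "(T ^^ n) c" y "(T ^^ n) x"]
          by (simp add: e_def)
      qed
      then show ?thesis using p(1) unfolding contains_fip_def good_def by blast
    qed
    then have "{n. dist ((T ^^ n) x) ((T ^^ n) c) > \<delta> / 2} \<in> F_fip" unfolding F_fip_def by blast
    moreover have "c \<in> U" using c(1) by (simp add: W_def)
    ultimately show ?thesis using xU by blast
  qed
  then show ?thesis unfolding strongly_F_sensitive_def using \<delta> half_gt_zero by blast
qed

section \<open>The equivalence of (3) and (4)\<close>

lemma far_imp_not_almost_one_to_one:
  assumes "\<exists>\<delta>>0. \<forall>x\<in>X. \<exists>y\<in>X. (x, y) \<in> RP_inf X T \<and> dist x y \<ge> \<delta>"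
  shows "\<not> almost_one_to_one X (nil_factor_map X T)"
proof
  assume "almost_one_to_one X (nil_factor_map X T)"
  then have "{x \<in> X. {z \<in> X. nil_factor_map X T z = nil_factor_map X T x} = {x}} \<noteq> {}"
    using X_ne unfolding almost_one_to_one_def by (metis closure_empty subset_empty)
  then obtain x where x: "x \<in> X" "{z \<in> X. nil_factor_map X T z = nil_factor_map X T x} = {x}" by blast
  obtain y where y: "y \<in> X" "(x, y) \<in> RP_inf X T" "dist x y > 0"
    using assms x(1) by (meson order_less_le_trans)
  then have "y \<in> {z \<in> X. nil_factor_map X T z = nil_factor_map X T x}" using nil_factor_map_eq by simp
  then show False using x(2) y(3) by simp
qed

lemma finite_uniform_equicontinuous:
  assumes "e > 0"
  shows "\<exists>\<eta>>0. \<forall>i<M. \<forall>a\<in>X. \<forall>b\<in>X. dist a b < \<eta> \<longrightarrow> dist ((T ^^ i) a) ((T ^^ i) b) < e"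
proof (induction M)
  case 0
  then show ?case by (intro exI[of _ 1]) simp
next
  case (Suc M)
  then obtain \<eta> where \<eta>: "\<eta> > 0" "\<forall>i<M. \<forall>a\<in>X. \<forall>b\<in>X. dist a b < \<eta> \<longrightarrow> dist ((T ^^ i) a) ((T ^^ i) b) < e" by blast
  obtain \<eta>' where \<eta>': "\<eta>' > 0" "\<forall>a\<in>X. \<forall>b\<in>X. dist b a < \<eta>' \<longrightarrow> dist ((T ^^ M) b) ((T ^^ M) a) < e"
    using compact_uniformly_continuous[OF Tn_cont cpt, of M] assms unfolding uniformly_continuous_on_def by blast
  have "\<forall>i<Suc M. \<forall>a\<in>X. \<forall>b\<in>X. dist a b < min \<eta> \<eta>' \<longrightarrow> dist ((T ^^ i) a) ((T ^^ i) b) < e"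
    using \<eta>(2) \<eta>'(2) by (auto simp: less_Suc_eq)
  then show ?case using \<eta>(1) \<eta>'(1) by (intro exI[of _ "min \<eta> \<eta>'"]) simp
qed

text \<open>The points whose class has radius below \<open>e\<close> form an open set, its
  complement being the projection of a compact set. It is dense because a point with a very small
  class can be carried into any open set in bounded time, the relation being invariant. Points lying
  in these sets for all \<open>e = 1 / real (Suc n)\<close> have singleton fibres.\<close>

lemma not_far_imp_almost_one_to_one:
  assumes nfar: "\<not> (\<exists>\<delta>>0. \<forall>x\<in>X. \<exists>y\<in>X. (x, y) \<in> RP_inf X T \<and> dist x y \<ge> \<delta>)"
  shows "almost_one_to_one X (nil_factor_map X T)"
proof -
  define small where "small e = X - fst ` (RP_inf X T \<inter> {p. e \<le> dist (fst p) (snd p)})" for e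
  have small: "x \<in> small e \<longleftrightarrow> x \<in> X \<and> (\<forall>y. (x, y) \<in> RP_inf X T \<longrightarrow> dist x y < e)" for x e
    by (force simp: small_def not_le)
  have op: "openin (top_of_set X) (small e)" for e
  proof -
    have "closed {p::'a \<times> 'a. e \<le> dist (fst p) (snd p)}"
      by (intro closed_Collect_le continuous_intros)
    then have "closed (RP_inf X T \<inter> {p. e \<le> dist (fst p) (snd p)})" using closed_RP_inf by (rule closed_Int[rotated])
    moreover have "RP_inf X T \<subseteq> X \<times> X" using RP_inf_in by auto
    ultimately have "compact (RP_inf X T \<inter> {p. e \<le> dist (fst p) (snd p)})"
      using compact_Int_closed[OF compact_Times[OF cpt cpt]] by (metis inf.absorb2 inf.coboundedI1)
    then have "closed (fst ` (RP_inf X T \<inter> {p. e \<le> dist (fst p) (snd p)}))"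
      by (intro compact_imp_closed compact_continuous_image continuous_intros)
    then show ?thesis unfolding small_def Diff_eq by (intro openin_open_Int open_Compl)
  qed
  have dense: "small e \<inter> V \<noteq> {}" if V: "openin (top_of_set X) V" "V \<noteq> {}" and e: "e > 0" for V e
  proof -
    obtain M where M: "\<And>z. z \<in> X \<Longrightarrow> \<exists>i<M. (T ^^ i) z \<in> V" using syndetic_visits[OF V] by blast
    \<comment> \<open>The time \<open>i\<close> depends on \<open>x\<close>, and \<open>x\<close> on
      \<open>\<eta>\<close>; hence \<open>\<eta>\<close> must serve all times below the bound
      \<open>M\<close> at once.\<close>
    obtain \<eta> where \<eta>: "\<eta> > 0" "\<forall>i<M. \<forall>a\<in>X. \<forall>b\<in>X. dist a b < \<eta> \<longrightarrow> dist ((T ^^ i) a) ((T ^^ i) b) < e"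
      using finite_uniform_equicontinuous[OF e] by blast
    obtain x where x: "x \<in> X" "\<And>y. y \<in> X \<Longrightarrow> (x, y) \<in> RP_inf X T \<Longrightarrow> dist x y < \<eta>"
      using nfar \<eta>(1) by (meson not_le)
    obtain i where i: "i < M" "(T ^^ i) x \<in> V" using M[OF x(1)] by blast
    have "dist ((T ^^ i) x) y < e" if y: "((T ^^ i) x, y) \<in> RP_inf X T" for y
    proof -
      have yX: "y \<in> X" using RP_inf_in[OF y] by simp
      define y' where "y' = act (- int i) y"
      have y'X: "y' \<in> X" unfolding y'_def using yX by (rule g_in)
      have "act (- int i) ((T ^^ i) x) = x" using act_nat[OF x(1), of i] g_add[of "- int i" "int i" x] g_0 by simp
      then have "(x, y') \<in> RP_inf X T"
        using y reg_prox_invariant[of _ "(T ^^ i) x" y "- int i"] unfolding RP_inf_iff y'_def by metis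
      then have "dist x y' < \<eta>" using x(2) y'X by blast
      then have "dist ((T ^^ i) x) ((T ^^ i) y') < e" using \<eta>(2) i(1) x(1) y'X by blast
      moreover have "(T ^^ i) y' = y"
        using act_nat[OF y'X, of i] g_add[of "int i" "- int i" y] g_0 by (simp add: y'_def)
      ultimately show ?thesis by simp
    qed
    then have "(T ^^ i) x \<in> small e" using Tn_in[OF x(1)] small by blast
    then show ?thesis using i(2) by blast
  qed
  show ?thesis unfolding almost_one_to_one_def
  proof
    fix x assume x: "x \<in> X"
    show "x \<in> closure {x \<in> X. {z \<in> X. nil_factor_map X T z = nil_factor_map X T x} = {x}}"
      unfolding closure_approachable
    proof (intro allI impI)
      fix e :: real assume e: "e > 0"
      define V where "V = X \<inter> ball x e"
      have V: "openin (top_of_set X) V" "V \<noteq> {}" unfolding V_def using x e by (auto simp: openin_open_Int)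
      have "small (1 / real (Suc n)) \<inter> V' \<noteq> {}" if "openin (top_of_set X) V'" "V' \<noteq> {}" for n V'
        using that by (rule dense) simp
      then obtain c where c: "c \<in> V" "\<And>n. c \<in> small (1 / real (Suc n))"
        using Baire_compact[OF cpt op _ V, of "\<lambda>n. 1 / real (Suc n)"] by metis
      have "z = c" if z: "z \<in> X" "nil_factor_map X T z = nil_factor_map X T c" for z
      proof (rule ccontr)
        assume "z \<noteq> c"
        have "z \<in> nil_factor_map X T z" unfolding nil_factor_map_def using RP_inf_refl[OF z(1)] by simp
        then have "z \<in> nil_factor_map X T c" using z(2) by simp
        then have cz: "(c, z) \<in> RP_inf X T" by (simp add: nil_factor_map_def)
        obtain n where "1 / real (Suc n) < dist c z"
          using reals_Archimedean[of "dist c z"] \<open>z \<noteq> c\<close> by (auto simp: inverse_eq_divide)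
        moreover have "dist c z < 1 / real (Suc n)" using c(2) small cz by blast
        ultimately show False by simp
      qed
      moreover have "c \<in> X" "dist c x < e" using c(1) by (auto simp: V_def dist_commute)
      ultimately show "\<exists>y\<in>{x \<in> X. {z \<in> X. nil_factor_map X T z = nil_factor_map X T x} = {x}}. dist y x < e"
        by (intro bexI[of _ c]) auto
    qed
  qed
qed

end

theorem theorem4p4:
  fixes X :: "'a::metric_space set" and T :: "'a \<Rightarrow> 'a"
  assumes "tds X T" and "minimal_sys X T" and "\<exists>S. homeomorphism X X T S"
  shows "(strongly_F_sensitive F_fip X T \<longleftrightarrow> block_Fip_sensitive X T)
    \<and> (block_Fip_sensitive X T \<longleftrightarrow>
         (\<exists>\<delta>>0. \<forall>x\<in>X. \<exists>y\<in>X. (x, y) \<in> RP_inf X T \<and> dist x y \<ge> \<delta>))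
    \<and> ((\<exists>\<delta>>0. \<forall>x\<in>X. \<exists>y\<in>X. (x, y) \<in> RP_inf X T \<and> dist x y \<ge> \<delta>) \<longleftrightarrow>
         \<not> almost_one_to_one X (nil_factor_map X T))"
proof -
  interpret minimal_homeomorphism X T using assms by (rule minimal_homeomorphism.intro)
  show ?thesis
    using sensitive_imp_block block_imp_far far_imp_sensitive far_imp_not_almost_one_to_one
      not_far_imp_almost_one_to_one by argo
qed

end
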